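(* Let $H\in\,]1/2,1[$, let $B$ be a real two-sided fractional Brownian motion of Hurst index $H$ on its canonical space $(\Omega,\mathcal A,\mathbb P)$ with Wiener shift $\theta$, let $\lambda>0$ and $\sigma\in\mathbb R\setminus\{0\}$, and let $$X(t)=\int_{-\infty}^{t}\sigma e^{-\lambda(t-s)}\,dB(s),\quad t\in\mathbb R,$$ be the (stationary) fractional Ornstein-Uhlenbeck process, i.e. the solution of $dX(t)=-\lambda X(t)\,dt+\sigma\,dB(t)$, $t\in\mathbb R$. Then $X$ is not almost periodic in square mean, but $X$ is $\theta$-almost periodic in square mean.
   Context: Canonical space: $\Omega$ is the space of continuous functions $\omega:\mathbb R\to\mathbb R$ with $\omega(0)=0$, $\mathcal A$ its Borel $\sigma$-algebra, $\mathbb P$ the law of the two-sided fractional Brownian motion, $B(t,\omega)=\omega(t)$, and $\theta_t\omega:=\omega(t+\cdot)-\omega(t)$ (Wiener shift). The integral over $]-\infty,t]$ is the $\mathbb L^2$-limit as $s\to\infty$ of the Wiener integrals over $[-s,t]$, which are $\mathbb L^2$-limits of Riemann sums. A set $E\subset\mathbb R$ is relatively dense if there is $l>0$ such that every interval of length $l$ meets $E$. A process $Y$ with $Y(t)\in\mathbb L^2(\Omega)$ is almost periodic in square mean if $t\mapsto Y(t)\in\mathbb L^2(\Omega)$ is continuous and, for every $\varepsilon>0$, the set of $\tau\in\mathbb R$ with $\sup_{t\in\mathbb R}\mathbb E(|Y(t+\tau)-Y(t)|^2)^{1/2}\leqslant\varepsilon$ is relatively dense. With $\mathfrak T_\tau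 Y(t,\omega):=Y(t+\tau,\theta_{-\tau}\omega)$, $Y$ is $\theta$-almost periodic in square mean if $(t,\tau)\mapsto\mathfrak T_\tau Y(t)\in\mathbb L^2(\Omega)$ is continuous and, for every $\varepsilon>0$, the set of $\tau\in\mathbb R$ with $\sup_{t\in\mathbb R}\mathbb E(|\mathfrak T_\tau Y(t)-Y(t)|^2)^{1/2}\leqslant\varepsilon$ is relatively dense. *)

theory Defs
  imports "HOL-Probability.Probability"
begin

definition path_space :: "(real \<Rightarrow> real) set" where
  "path_space = {\<omega>. continuous_on UNIV \<omega> \<and> \<omega> 0 = 0}"

text \<open>The compact-open topology, which on continuous functions is the topology of
  uniform convergence on compact sets. Its carrier is all of \<open>path_space\<close>
  (take \<open>K = {}\<close>).\<close>

definition path_topology :: "(real \<Rightarrow> real) topology" where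
  "path_topology = topology_generated_by
     {{\<omega> \<in> path_space. \<omega> ` K \<subseteq> U} |K U. compact K \<and> open U}"

definition path_borel :: "(real \<Rightarrow> real) measure" where
  "path_borel = sigma path_space {U. openin path_topology U}"

definition coord :: "real \<Rightarrow> (real \<Rightarrow> real) \<Rightarrow> real" where
  "coord t \<omega> = \<omega> t"

definition wiener_shift :: "real \<Rightarrow> (real \<Rightarrow> real) \<Rightarrow> (real \<Rightarrow> real)" where
  "wiener_shift t \<omega> = (\<lambda>s. \<omega> (t + s) - \<omega> t)"


text \<open>Degenerate (almost surely constant) variables count as Gaussian.\<close>

definition gaussian_rv :: "'a measure \<Rightarrow> ('a \<Rightarrow> real) \<Rightarrow> bool" where
  "gaussian_rv M Z \<longleftrightarrow> Z \<in> borel_measurable M \<and>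
     (\<exists>\<mu>. (AE \<omega> in M. Z \<omega> = \<mu>) \<or>
          (\<exists>\<sigma>>0. distributed M lborel Z (normal_density \<mu> \<sigma>)))"

definition gaussian_process :: "'a measure \<Rightarrow> (real \<Rightarrow> 'a \<Rightarrow> real) \<Rightarrow> bool" where
  "gaussian_process M Y \<longleftrightarrow>
     (\<forall>T c. finite T \<longrightarrow> gaussian_rv M (\<lambda>\<omega>. \<Sum>t\<in>T. c t * Y t \<omega>))"

definition fractional_brownian_motion ::
    "real \<Rightarrow> 'a measure \<Rightarrow> (real \<Rightarrow> 'a \<Rightarrow> real) \<Rightarrow> bool" where
  "fractional_brownian_motion H M B \<longleftrightarrow>
     prob_space M \<and>
     gaussian_process M B \<and>
     (\<forall>\<omega>\<in>space M. continuous_on UNIV (\<lambda>t. B t \<omega>)) \<and>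
     (\<forall>t. (\<integral>\<omega>. B t \<omega> \<partial>M) = 0) \<and>
     (\<forall>s t. (\<integral>\<omega>. B s \<omega> * B t \<omega> \<partial>M) =
        (\<bar>s\<bar> powr (2 * H) + \<bar>t\<bar> powr (2 * H) - \<bar>t - s\<bar> powr (2 * H)) / 2)"

text \<open>\<open>P\<close> is the law of the fractional Brownian motion iff it is a measure on the
  canonical space under which the coordinate process is one.\<close>

definition fbm_law :: "real \<Rightarrow> (real \<Rightarrow> real) measure \<Rightarrow> bool" where
  "fbm_law H P \<longleftrightarrow> sets P = sets path_borel \<and> fractional_brownian_motion H P coord"


definition square_integrable :: "'a measure \<Rightarrow> ('a \<Rightarrow> real) \<Rightarrow> bool" where
  "square_integrable M Z \<longleftrightarrow>
     Z \<in> borel_measurable M \<and> integrable M (\<lambda>\<omega>. (Z \<omega>)\<^sup>2)"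

definition L2_dist :: "'a measure \<Rightarrow> ('a \<Rightarrow> real) \<Rightarrow> ('a \<Rightarrow> real) \<Rightarrow> real" where
  "L2_dist M Y Z = sqrt (\<integral>\<omega>. \<bar>Y \<omega> - Z \<omega>\<bar>\<^sup>2 \<partial>M)"

text \<open>Membership in \<open>L\<^sup>2\<close> has to be required explicitly, because the Bochner integral
  of a non-integrable function is \<open>0\<close>.\<close>

definition L2_tendsto ::
    "'a measure \<Rightarrow> ('i \<Rightarrow> 'a \<Rightarrow> real) \<Rightarrow> ('a \<Rightarrow> real) \<Rightarrow> 'i filter \<Rightarrow> bool" where
  "L2_tendsto M Y Z F \<longleftrightarrow>
     square_integrable M Z \<and>
     (\<forall>\<^sub>F i in F. square_integrable M (Y i)) \<and>
     ((\<lambda>i. L2_dist M (Y i) Z) \<longlongrightarrow> 0) F"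

definition L2_continuous ::
    "'a measure \<Rightarrow> ('i::topological_space \<Rightarrow> 'a \<Rightarrow> real) \<Rightarrow> bool" where
  "L2_continuous M Y \<longleftrightarrow> (\<forall>p. L2_tendsto M Y (Y p) (at p))"

text \<open>Tagged divisions of \<open>[a,b]\<close> with mesh tending to \<open>0\<close> (Riemann, not gauge,
  fineness).\<close>

definition mesh_filter :: "real \<Rightarrow> real \<Rightarrow> (real \<times> real set) set filter" where
  "mesh_filter a b = (INF \<delta>\<in>{0<..}.
     principal {D. D tagged_division_of {a..b} \<and> (\<forall>(x, K)\<in>D. diameter K < \<delta>)})"

definition riemann_sum ::
    "(real \<Rightarrow> 'a \<Rightarrow> real) \<Rightarrow> (real \<Rightarrow> real) \<Rightarrow> (real \<times> real set) set \<Rightarrow> 'a \<Rightarrow> real" where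
  "riemann_sum B f D \<omega> = (\<Sum>(x, K)\<in>D. f x * (B (Sup K) \<omega> - B (Inf K) \<omega>))"

text \<open>\<open>L\<^sup>2\<close>-limits are only determined almost surely, so the integrals are relations
  satisfied by every version of the integral.\<close>

definition has_wiener_integral ::
    "'a measure \<Rightarrow> (real \<Rightarrow> 'a \<Rightarrow> real) \<Rightarrow> (real \<Rightarrow> real) \<Rightarrow> real \<Rightarrow> real \<Rightarrow> ('a \<Rightarrow> real) \<Rightarrow> bool"
  where
  "has_wiener_integral M B f a b I \<longleftrightarrow> L2_tendsto M (riemann_sum B f) I (mesh_filter a b)"

definition has_wiener_integral_upto ::
    "'a measure \<Rightarrow> (real \<Rightarrow> 'a \<Rightarrow> real) \<Rightarrow> (real \<Rightarrow> real) \<Rightarrow> real \<Rightarrow> ('a \<Rightarrow> real) \<Rightarrow> bool"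
  where
  "has_wiener_integral_upto M B f t I \<longleftrightarrow>
     (\<exists>J. (\<forall>s. - s \<le> t \<longrightarrow> has_wiener_integral M B f (- s) t (J s)) \<and>
          L2_tendsto M J I at_top)"


definition relatively_dense :: "real set \<Rightarrow> bool" where
  "relatively_dense E \<longleftrightarrow> (\<exists>l>0. \<forall>a. {a..a + l} \<inter> E \<noteq> {})"

definition almost_periodic_sq :: "'a measure \<Rightarrow> (real \<Rightarrow> 'a \<Rightarrow> real) \<Rightarrow> bool" where
  "almost_periodic_sq M Y \<longleftrightarrow>
     L2_continuous M Y \<and>
     (\<forall>\<epsilon>>0. relatively_dense
        {\<tau>. (SUP t. ereal (L2_dist M (Y (t + \<tau>)) (Y t))) \<le> ereal \<epsilon>})"

definition shift_process ::
    "real \<Rightarrow> (real \<Rightarrow> (real \<Rightarrow> real) \<Rightarrow> real) \<Rightarrow> real \<Rightarrow> (real \<Rightarrow> real) \<Rightarrow> real" where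
  "shift_process \<tau> Y t \<omega> = Y (t + \<tau>) (wiener_shift (- \<tau>) \<omega>)"

definition theta_almost_periodic_sq ::
    "(real \<Rightarrow> real) measure \<Rightarrow> (real \<Rightarrow> (real \<Rightarrow> real) \<Rightarrow> real) \<Rightarrow> bool" where
  "theta_almost_periodic_sq P Y \<longleftrightarrow>
     L2_continuous P (\<lambda>(t, \<tau>). shift_process \<tau> Y t) \<and>
     (\<forall>\<epsilon>>0. relatively_dense
        {\<tau>. (SUP t. ereal (L2_dist P (shift_process \<tau> Y t) (Y t))) \<le> ereal \<epsilon>})"

end

(* The law of a Gaussian process is determined by its covariance, and the increments of fractional
   Brownian motion B are stationary; hence the Wiener shift preserves P. It turns Riemann sums of the
   integral defining X(t + tau) into Riemann sums of the integral defining X(t), so that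
   X(t + tau) o theta_{-tau} = X(t) almost surely, for every tau.

   On the other hand, X(t + h) - exp(-lam h) X(t) agrees with sigma (B(t + h) - B(t)) up to an error of
   L2 norm at most |sigma| (1 - exp(-lam h)) h^H, because increments of B over disjoint intervals are
   nonnegatively correlated. Fix a small h. An L2 almost period tau of X would be, up to this
   error, an almost period of t |-> B(t + h) - B(t). But the correlation of B(tau + h) - B(tau) and
   B(h) - B(0) tends to 0 as tau tends to infinity, so large tau are not almost periods. *)
theory Submission
  imports Defs "HOL-Real_Asymp.Real_Asymp"
begin

section \<open>Square integrable functions\<close>

text \<open>That the covariance determines the law rests on two facts. The Borel sets of the
  compact-open topology are generated by finite-dimensional cylinders, and equality of
  finite-dimensional laws follows from one-dimensional Levy uniqueness, because the Gaussian
  hypothesis speaks only of single linear combinations \<open>L\<close> of coordinates. These enter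
  through the integrals of \<open>cos (L + \<phi>)\<close>, where the free phase
  \<open>\<phi>\<close> replaces complex exponentials. Integrals are relations here:
  \<open>X t\<close> is any version, chosen separately for each \<open>t\<close>. Identities for
  \<open>X\<close> are therefore proved on Riemann sums, where they hold path by path, and then
  carried over in L2 distance through two limits, mesh to zero and lower endpoint to minus infinity.
  The bounds have to be uniform in both. The one-step estimate stands in for a computation of the
  covariance of \<open>X\<close>, and it also yields the L2 continuity.\<close>

definition L2_norm :: "'a measure \<Rightarrow> ('a \<Rightarrow> real) \<Rightarrow> real" where
  "L2_norm M f = sqrt (\<integral>\<omega>. (f \<omega>)\<^sup>2 \<partial>M)"

lemma L2_dist_eq_norm: "L2_dist M f g = L2_norm M (\<lambda>\<omega>. f \<omega> - g \<omega>)"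
  by (simp add: L2_dist_def L2_norm_def)

lemma square_integrable_measurable [measurable_dest]:
  "square_integrable M f \<Longrightarrow> f \<in> borel_measurable M"
  by (simp add: square_integrable_def)

lemma L2_norm_nonneg [simp]: "0 \<le> L2_norm M f"
  by (simp add: L2_norm_def)

lemma L2_norm_power2: "(L2_norm M f)\<^sup>2 = (\<integral>\<omega>. (f \<omega>)\<^sup>2 \<partial>M)"
  by (simp add: L2_norm_def)

lemma square_integrable_mult_integrable:
  assumes "square_integrable M f" "square_integrable M g"
  shows "integrable M (\<lambda>\<omega>. f \<omega> * g \<omega>)"
proof (rule Bochner_Integration.integrable_bound)
  show "integrable M (\<lambda>\<omega>. (f \<omega>)\<^sup>2 + (g \<omega>)\<^sup>2)"
    using assms by (simp add: square_integrable_def)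
  show "(\<lambda>\<omega>. f \<omega> * g \<omega>) \<in> borel_measurable M"
    using assms by (auto simp: square_integrable_def)
  have "\<bar>x * y\<bar> \<le> \<bar>x\<^sup>2 + y\<^sup>2\<bar>" for x y :: real
  proof -
    have "0 \<le> (x + y)\<^sup>2" "0 \<le> (x - y)\<^sup>2" "0 \<le> x\<^sup>2" "0 \<le> y\<^sup>2" by simp_all
    then show ?thesis
      unfolding power2_sum power2_diff abs_le_iff by linarith
  qed
  then show "AE x in M. norm (f x * g x) \<le> norm ((f x)\<^sup>2 + (g x)\<^sup>2)"
    by simp
qed

lemma square_integrable_zero [simp]: "square_integrable M (\<lambda>\<omega>. 0)"
  by (simp add: square_integrable_def)

lemma square_integrable_add:
  assumes "square_integrable M f" "square_integrable M g"
  shows "square_integrable M (\<lambda>\<omega>. f \<omega> + g \<omega>)"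
  using assms square_integrable_mult_integrable[OF assms]
  by (auto simp: square_integrable_def power2_sum mult.assoc)

lemma square_integrable_scale:
  assumes "square_integrable M f"
  shows "square_integrable M (\<lambda>\<omega>. c * f \<omega>)"
  using assms by (auto simp: square_integrable_def power_mult_distrib)

lemma square_integrable_diff:
  assumes "square_integrable M f" "square_integrable M g"
  shows "square_integrable M (\<lambda>\<omega>. f \<omega> - g \<omega>)"
  using square_integrable_add[OF assms(1) square_integrable_scale[OF assms(2), of "-1"]] by simp

lemma square_integrable_sum:
  assumes "\<And>i. i \<in> I \<Longrightarrow> square_integrable M (f i)"
  shows "square_integrable M (\<lambda>\<omega>. \<Sum>i\<in>I. f i \<omega>)"
  using assms by (induction I rule: infinite_finite_induct) (auto intro: square_integrable_add)

lemma L2_norm_scale: "L2_norm M (\<lambda>\<omega>. c * f \<omega>) = \<bar>c\<bar> * L2_norm M f"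
  by (simp add: L2_norm_def power_mult_distrib real_sqrt_mult)

lemma L2_norm_minus_commute: "L2_norm M (\<lambda>\<omega>. f \<omega> - g \<omega>) = L2_norm M (\<lambda>\<omega>. g \<omega> - f \<omega>)"
  by (simp add: L2_norm_def power2_commute)

text \<open>Two-term Cauchy-Schwarz in Engel form: the two sides differ by a square over
  \<open>p * q\<close>. Taking \<open>p\<close> and \<open>q\<close> close to the norms of
  \<open>f\<close> and \<open>g\<close> and integrating gives Minkowski's inequality.\<close>

lemma power2_sum_le_weighted:
  fixes x y p q :: real
  assumes "p > 0" "q > 0"
  shows "(x + y)\<^sup>2 \<le> (p + q) * (x\<^sup>2 / p + y\<^sup>2 / q)"
proof -
  have "(p + q) * (x\<^sup>2 / p + y\<^sup>2 / q) - (x + y)\<^sup>2 = (q * x - p * y)\<^sup>2 / (p * q)"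
    using assms by (simp add: field_simps power2_eq_square)
  moreover have "(q * x - p * y)\<^sup>2 / (p * q) \<ge> 0"
    using assms by simp
  ultimately show ?thesis by linarith
qed

lemma L2_norm_triangle:
  assumes f: "square_integrable M f" and g: "square_integrable M g"
  shows "L2_norm M (\<lambda>\<omega>. f \<omega> + g \<omega>) \<le> L2_norm M f + L2_norm M g"
proof (rule field_le_epsilon)
  fix e :: real assume "e > 0"
  \<comment> \<open>The extra \<open>e / 2\<close> keeps both weights positive even when a norm
    vanishes.\<close>
  define p where "p = L2_norm M f + e / 2"
  define q where "q = L2_norm M g + e / 2"
  have pq: "p > 0" "q > 0" "L2_norm M f \<le> p" "L2_norm M g \<le> q"
    using \<open>e > 0\<close> L2_norm_nonneg[of M f] L2_norm_nonneg[of M g] by (simp_all add: p_def q_def add_nonneg_pos)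
  have int: "integrable M (\<lambda>\<omega>. (f \<omega>)\<^sup>2)" "integrable M (\<lambda>\<omega>. (g \<omega>)\<^sup>2)"
    using f g by (auto simp: square_integrable_def)
  have "(\<integral>\<omega>. (f \<omega> + g \<omega>)\<^sup>2 \<partial>M) \<le> (\<integral>\<omega>. (p + q) * ((f \<omega>)\<^sup>2 / p + (g \<omega>)\<^sup>2 / q) \<partial>M)"
    using square_integrable_add[OF f g] int pq
    by (intro integral_mono power2_sum_le_weighted) (auto simp: square_integrable_def)
  also have "\<dots> = (p + q) * ((L2_norm M f)\<^sup>2 / p + (L2_norm M g)\<^sup>2 / q)"
    using int by (simp add: L2_norm_power2)
  also have "\<dots> \<le> (p + q) * (p\<^sup>2 / p + q\<^sup>2 / q)"
    using pq by (intro mult_left_mono add_mono divide_right_mono power_mono) auto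
  also have "\<dots> = (p + q)\<^sup>2"
    using pq by (simp add: power2_eq_square)
  finally have "L2_norm M (\<lambda>\<omega>. f \<omega> + g \<omega>) \<le> p + q"
    using pq real_le_lsqrt[of "(p+q)"] by (simp add: L2_norm_def real_le_lsqrt)
  then show "L2_norm M (\<lambda>\<omega>. f \<omega> + g \<omega>) \<le> L2_norm M f + L2_norm M g + e"
    by (simp add: p_def q_def)
qed

lemma L2_norm_triangle_diff:
  assumes "square_integrable M f" "square_integrable M g"
  shows "L2_norm M (\<lambda>\<omega>. f \<omega> - g \<omega>) \<le> L2_norm M f + L2_norm M g"
  using L2_norm_triangle[OF assms(1) square_integrable_scale[OF assms(2), of "-1"]]
    L2_norm_scale[of M "-1" g] by simp

lemma L2_dist_commute: "L2_dist M f g = L2_dist M g f"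
  unfolding L2_dist_eq_norm by (rule L2_norm_minus_commute)

lemma L2_dist_nonneg [simp]: "0 \<le> L2_dist M f g"
  by (simp add: L2_dist_eq_norm)

lemma L2_dist_triangle:
  assumes "square_integrable M f" "square_integrable M g" "square_integrable M h"
  shows "L2_dist M f h \<le> L2_dist M f g + L2_dist M g h"
  using L2_norm_triangle[OF square_integrable_diff[OF assms(1,2)] square_integrable_diff[OF assms(2,3)]]
  by (simp add: L2_dist_eq_norm)

section \<open>Uniqueness of laws with given characteristic functional\<close>

text \<open>The phase \<open>- pi / 2\<close> turns the sine into a cosine, so that the real and the
  imaginary part are two instances of one family of cosine integrals.\<close>

lemma char_weighted_distr:
  fixes W Y :: "'a \<Rightarrow> real"
  assumes [measurable]: "W \<in> borel_measurable M" "Y \<in> borel_measurable M"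
    and "\<And>\<omega>. 0 \<le> W \<omega>" "integrable M W"
  shows "char (distr (density M W) borel Y) u =
    Complex (\<integral>\<omega>. W \<omega> * cos (u * Y \<omega>) \<partial>M) (\<integral>\<omega>. W \<omega> * cos (u * Y \<omega> - pi / 2) \<partial>M)"
proof -
  have "char (distr (density M W) borel Y) u = (CLINT \<omega>|M. W \<omega> *\<^sub>R iexp (u * Y \<omega>))"
    unfolding char_def using assms(3)
    by (subst integral_distr) (auto simp: integral_density)
  moreover have int: "complex_integrable M (\<lambda>\<omega>. W \<omega> *\<^sub>R iexp (u * Y \<omega>))"
    by (rule Bochner_Integration.integrable_bound[OF assms(4)]) auto
  have "Re (CLINT \<omega>|M. W \<omega> *\<^sub>R iexp (u * Y \<omega>)) = (\<integral>\<omega>. W \<omega> * cos (u * Y \<omega>) \<partial>M)"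
    by (subst integral_Re[OF int, symmetric]) (auto simp: Re_exp)
  moreover have "Im (CLINT \<omega>|M. W \<omega> *\<^sub>R iexp (u * Y \<omega>)) = (\<integral>\<omega>. W \<omega> * cos (u * Y \<omega> - pi / 2) \<partial>M)"
    by (subst integral_Im[OF int, symmetric]) (auto simp: Im_exp cos_diff)
  ultimately show ?thesis
    by (simp add: complex_eq_iff)
qed

text \<open>Normalised by its integral \<open>c\<close>, the weight becomes a probability density;
  the hypothesis says that \<open>Y\<close> has the same characteristic function under the two
  weighted measures, and Levy uniqueness applies. If \<open>c = 0\<close>, the weight vanishes
  almost everywhere under both measures.\<close>

lemma weighted_law_eq:
  fixes W Y :: "'a \<Rightarrow> real"
  assumes M: "prob_space M" and N: "prob_space N" and sets: "sets M = sets N"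
    and [measurable]: "W \<in> borel_measurable M" "Y \<in> borel_measurable M" "A \<in> sets borel"
    and W: "\<And>\<omega>. 0 \<le> W \<omega>" "\<And>\<omega>. W \<omega> \<le> b"
    and eq: "\<And>u \<phi>. (\<integral>\<omega>. W \<omega> * cos (u * Y \<omega> + \<phi>) \<partial>M) = (\<integral>\<omega>. W \<omega> * cos (u * Y \<omega> + \<phi>) \<partial>N)"
  shows "(\<integral>\<omega>. W \<omega> * indicator A (Y \<omega>) \<partial>M) = (\<integral>\<omega>. W \<omega> * indicator A (Y \<omega>) \<partial>N)"
proof -
  interpret M: prob_space M by fact
  interpret N: prob_space N by fact
  have [measurable]: "W \<in> borel_measurable N" "Y \<in> borel_measurable N"
    by (simp_all add: measurable_cong_sets[OF sets[symmetric] refl])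
  have int: "integrable M W" "integrable N W"
    using W by (auto intro!: M.integrable_const_bound[of _ b] N.integrable_const_bound[of _ b])
  define c where "c = (\<integral>\<omega>. W \<omega> \<partial>M)"
  \<comment> \<open>The instance \<open>u = 0\<close>, \<open>\<phi> = 0\<close> of the hypothesis:
    both measures need the same normalising constant.\<close>
  have c: "c = (\<integral>\<omega>. W \<omega> \<partial>N)"
    using eq[of 0 0] by (simp add: c_def)
  show ?thesis
  proof (cases "c = 0")
    case True
    have "AE \<omega> in M. W \<omega> = 0" "AE \<omega> in N. W \<omega> = 0"
      using True c W(1) int integral_nonneg_eq_0_iff_AE[of M W] integral_nonneg_eq_0_iff_AE[of N W]
      unfolding c_def by auto
    then have "AE \<omega> in M. W \<omega> * indicator A (Y \<omega>) = 0" "AE \<omega> in N. W \<omega> * indicator A (Y \<omega>) = 0"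
      by auto
    then show ?thesis
      by (simp add: integral_eq_zero_AE)
  next
    case False
    then have "c > 0"
      using W(1) by (simp add: c_def less_le)
    define V where "V = (\<lambda>\<omega>. W \<omega> / c)"
    have [measurable]: "V \<in> borel_measurable M" "V \<in> borel_measurable N"
      by (auto simp: V_def)
    have V: "\<And>\<omega>. 0 \<le> V \<omega>" "integrable M V" "integrable N V"
      using W(1) \<open>c > 0\<close> int by (auto simp: V_def)
    define M1 where "M1 = distr (density M V) borel Y"
    define N1 where "N1 = distr (density N V) borel Y"
    have "(\<integral>\<^sup>+\<omega>. ennreal (V \<omega>) \<partial>M) = ennreal (\<integral>\<omega>. V \<omega> \<partial>M)"
         "(\<integral>\<^sup>+\<omega>. ennreal (V \<omega>) \<partial>N) = ennreal (\<integral>\<omega>. V \<omega> \<partial>N)"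
      using V by (auto intro: nn_integral_eq_integral)
    moreover have "(\<integral>\<omega>. V \<omega> \<partial>M) = 1" "(\<integral>\<omega>. V \<omega> \<partial>N) = 1"
      using \<open>c > 0\<close> c by (auto simp: V_def c_def[symmetric])
    ultimately have "prob_space (density M V)" "prob_space (density N V)"
      by (auto intro!: prob_spaceI simp: emeasure_density cong: nn_integral_cong_simp)
    then have real: "real_distribution M1" "real_distribution N1"
      unfolding M1_def N1_def by (auto intro!: prob_space.real_distribution_distr)
    have ind: "measure M1 A = (\<integral>\<omega>. V \<omega> * indicator A (Y \<omega>) \<partial>M)"
         "measure N1 A = (\<integral>\<omega>. V \<omega> * indicator A (Y \<omega>) \<partial>N)"
    proof -
      have "measure M1 A = (\<integral>x. indicator A x \<partial>M1)" "measure N1 A = (\<integral>x. indicator A x \<partial>N1)"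
        by (simp_all add: M1_def N1_def)
      moreover have "(\<integral>x. indicator A x \<partial>M1) = (\<integral>\<omega>. V \<omega> * indicator A (Y \<omega>) \<partial>M)"
        unfolding M1_def using V(1) by (subst integral_distr, simp, simp, subst integral_density) auto
      moreover have "(\<integral>x. indicator A x \<partial>N1) = (\<integral>\<omega>. V \<omega> * indicator A (Y \<omega>) \<partial>N)"
        unfolding N1_def using V(1) by (subst integral_distr, simp, simp, subst integral_density) auto
      ultimately show "measure M1 A = (\<integral>\<omega>. V \<omega> * indicator A (Y \<omega>) \<partial>M)"
         "measure N1 A = (\<integral>\<omega>. V \<omega> * indicator A (Y \<omega>) \<partial>N)"
        by simp_all
    qed
    have eqV: "(\<integral>\<omega>. V \<omega> * cos (u * Y \<omega> + \<phi>) \<partial>M) = (\<integral>\<omega>. V \<omega> * cos (u * Y \<omega> + \<phi>) \<partial>N)" for u \<phi>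
      using eq[of u \<phi>] by (simp add: V_def)
    have "char M1 = char N1"
      unfolding M1_def N1_def
      using V eqV[of _ 0] eqV[of _ "- pi / 2"] by (intro ext) (simp add: char_weighted_distr)
    then have "M1 = N1"
      using real by (intro Levy_uniqueness)
    then have "(\<integral>\<omega>. V \<omega> * indicator A (Y \<omega>) \<partial>M) = (\<integral>\<omega>. V \<omega> * indicator A (Y \<omega>) \<partial>N)"
      using ind by simp
    then show ?thesis
      using \<open>c > 0\<close> by (simp add: V_def)
  qed
qed

text \<open>Adds one term to a linear combination whether or not \<open>k\<close> already occurs in
  \<open>T\<close>; in the first case the two coefficients at \<open>k\<close> add up.\<close>

lemma sum_insert_coeff:
  fixes c :: "'i \<Rightarrow> real"
  assumes "finite T"
  shows "(\<Sum>t\<in>insert k T. ((if t \<in> T then c t else 0) + (if t = k then u else 0)) * y t) =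
    (\<Sum>t\<in>T. c t * y t) + u * y k"
proof -
  have "(\<Sum>t\<in>insert k T. (if t \<in> T then c t else 0) * y t) = (\<Sum>t\<in>T. c t * y t)"
    using assms by (intro sum.mono_neutral_cong_right) auto
  moreover have "(\<Sum>t\<in>insert k T. (if t = k then u else 0) * y t) = u * y k"
    using assms by (simp add: if_distrib[of "\<lambda>x. x * _"] sum.delta cong: if_cong)
  ultimately show ?thesis
    by (simp add: distrib_right sum.distrib del: sum.insert)
qed

text \<open>Multivariate Levy uniqueness by induction on the number of coordinates: multiplied by an
  indicator of the previous coordinates, \<open>1 + cos L\<close> is a nonnegative weight, so the
  univariate theorem applies to the law of the next coordinate under it.\<close>

lemma cylinder_weighted_cos_eq:
  fixes Y :: "'i \<Rightarrow> 'a \<Rightarrow> real"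
  assumes M: "prob_space M" and N: "prob_space N" and sets: "sets M = sets N"
    and Y [measurable]: "\<And>i. Y i \<in> borel_measurable M"
    and eq: "\<And>T c \<phi>. finite T \<Longrightarrow>
      (\<integral>\<omega>. cos ((\<Sum>t\<in>T. c t * Y t \<omega>) + \<phi>) \<partial>M) = (\<integral>\<omega>. cos ((\<Sum>t\<in>T. c t * Y t \<omega>) + \<phi>) \<partial>N)"
    and "finite S" "\<And>i. i \<in> S \<Longrightarrow> A i \<in> sets borel" "finite T"
  shows "(\<integral>\<omega>. (\<Prod>i\<in>S. indicator (A i) (Y i \<omega>)) * cos ((\<Sum>t\<in>T. c t * Y t \<omega>) + \<phi>) \<partial>M) =
         (\<integral>\<omega>. (\<Prod>i\<in>S. indicator (A i) (Y i \<omega>)) * cos ((\<Sum>t\<in>T. c t * Y t \<omega>) + \<phi>) \<partial>N)"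
  using assms(6-)
proof (induction S arbitrary: T c \<phi> rule: finite_induct)
  case empty
  then show ?case using eq by simp
next
  case (insert k S)
  interpret M: prob_space M by fact
  interpret N: prob_space N by fact
  have YN [measurable]: "Y i \<in> borel_measurable N" for i
    using Y[of i] by (simp add: measurable_cong_sets[OF sets[symmetric] refl])
  define D :: "'a \<Rightarrow> real" where "D = (\<lambda>\<omega>. \<Prod>i\<in>S. indicator (A i) (Y i \<omega>))"
  have A [measurable]: "A k \<in> sets borel" "\<And>i. i \<in> S \<Longrightarrow> A i \<in> sets borel"
    using insert.prems by auto
  have D: "0 \<le> D \<omega>" "D \<omega> \<le> 1" for \<omega>
    unfolding D_def by (auto intro!: prod_nonneg prod_le_1)
  have Dm [measurable]: "D \<in> borel_measurable M" "D \<in> borel_measurable N"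
    unfolding D_def by measurable
  have IH: "(\<integral>\<omega>. D \<omega> * cos ((\<Sum>t\<in>T. c t * Y t \<omega>) + \<phi>) \<partial>M) = (\<integral>\<omega>. D \<omega> * cos ((\<Sum>t\<in>T. c t * Y t \<omega>) + \<phi>) \<partial>N)"
    if "finite T" for T c \<phi>
    using insert.IH insert.prems that unfolding D_def by auto
  define L where "L = (\<lambda>\<omega>. (\<Sum>t\<in>T. c t * Y t \<omega>) + \<phi>)"
  have Lm [measurable]: "L \<in> borel_measurable M" "L \<in> borel_measurable N"
    unfolding L_def by measurable
  \<comment> \<open>The extra term \<open>u * Y k\<close> is absorbed into the linear combination,
    which is why the induction keeps \<open>T\<close>, \<open>c\<close> and \<open>\<phi>\<close>
    arbitrary.\<close>
  have IH1: "(\<integral>\<omega>. D \<omega> * cos (L \<omega> + (u * Y k \<omega> + \<psi>)) \<partial>M) = (\<integral>\<omega>. D \<omega> * cos (L \<omega> + (u * Y k \<omega> + \<psi>)) \<partial>N)" for u \<psi>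
    using IH[of "insert k T" "\<lambda>t. (if t \<in> T then c t else 0) + (if t = k then u else 0)" "\<phi> + \<psi>"]
      insert.prems(2)
    unfolding sum_insert_coeff[OF insert.prems(2)] L_def by (simp add: ac_simps)
  have IH2: "(\<integral>\<omega>. D \<omega> * cos (u * Y k \<omega> + \<psi>) \<partial>M) = (\<integral>\<omega>. D \<omega> * cos (u * Y k \<omega> + \<psi>) \<partial>N)" for u \<psi>
    using IH[of "{k}" "\<lambda>_. u" \<psi>] by simp
  have DI: "integrable M (\<lambda>\<omega>. D \<omega> * cos (g \<omega>))" if "g \<in> borel_measurable M" for g
    using that D by (intro M.integrable_const_bound[of _ 1])
      (auto simp: abs_mult intro!: mult_le_one)
  have DIN: "integrable N (\<lambda>\<omega>. D \<omega> * cos (g \<omega>))" if "g \<in> borel_measurable N" for g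
    using that D by (intro N.integrable_const_bound[of _ 1])
      (auto simp: abs_mult intro!: mult_le_one)
  define W where "W = (\<lambda>\<omega>. D \<omega> * (1 + cos (L \<omega>)))"
  have "(\<integral>\<omega>. W \<omega> * indicator (A k) (Y k \<omega>) \<partial>M) = (\<integral>\<omega>. W \<omega> * indicator (A k) (Y k \<omega>) \<partial>N)"
  proof (rule weighted_law_eq[OF M N sets, where b = 2])
    have "0 \<le> 1 + cos (L \<omega>)" "1 + cos (L \<omega>) \<le> 2" for \<omega>
      using cos_ge_minus_one[of "L \<omega>"] cos_le_one[of "L \<omega>"] by linarith+
    then show "0 \<le> W \<omega>" "W \<omega> \<le> 2" for \<omega>
      unfolding W_def using D[of \<omega>] mult_mono[of "D \<omega>" 1 "1 + cos (L \<omega>)" 2] by auto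
    fix u \<psi>
    \<comment> \<open>Product-to-sum: \<open>cos L * cos v\<close> is half of
      \<open>cos (L + v) + cos (L - v)\<close>, so each term on the right is covered by the
      induction hypothesis.\<close>
    have W: "W \<omega> * cos (u * Y k \<omega> + \<psi>) = D \<omega> * cos (u * Y k \<omega> + \<psi>) +
       (D \<omega> * cos (L \<omega> + (u * Y k \<omega> + \<psi>)) + D \<omega> * cos (L \<omega> + ((-u) * Y k \<omega> + (-\<psi>)))) / 2" for \<omega>
      using cos_times_cos[of "L \<omega>" "u * Y k \<omega> + \<psi>"]
      by (simp add: W_def algebra_simps)
    show "(\<integral>\<omega>. W \<omega> * cos (u * Y k \<omega> + \<psi>) \<partial>M) = (\<integral>\<omega>. W \<omega> * cos (u * Y k \<omega> + \<psi>) \<partial>N)"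
      unfolding W using IH1[of u \<psi>] IH1[of "-u" "-\<psi>"] IH2
      by (subst (1 2) Bochner_Integration.integral_add)
        (auto intro!: DI DIN integrable_add simp: Bochner_Integration.integral_add DI DIN)
  qed (auto simp: W_def)
  moreover have "(\<integral>\<omega>. D \<omega> * indicator (A k) (Y k \<omega>) \<partial>M) = (\<integral>\<omega>. D \<omega> * indicator (A k) (Y k \<omega>) \<partial>N)"
    by (rule weighted_law_eq[OF M N sets, where b = 1]) (use D IH2 in auto)
  moreover have "integrable M (\<lambda>\<omega>. g \<omega> * indicator (A k) (Y k \<omega>))"
    if "g \<in> borel_measurable M" "\<And>\<omega>. \<bar>g \<omega>\<bar> \<le> 2" for g :: "'a \<Rightarrow> real"
    using that by (intro M.integrable_const_bound[of _ 2]) (auto simp: abs_mult indicator_def)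
  moreover have "integrable N (\<lambda>\<omega>. g \<omega> * indicator (A k) (Y k \<omega>))"
    if "g \<in> borel_measurable N" "\<And>\<omega>. \<bar>g \<omega>\<bar> \<le> 2" for g :: "'a \<Rightarrow> real"
    using that by (intro N.integrable_const_bound[of _ 2]) (auto simp: abs_mult indicator_def)
  moreover have "\<bar>W \<omega>\<bar> \<le> 2" "\<bar>D \<omega>\<bar> \<le> 2" for \<omega>
  proof -
    show "\<bar>D \<omega>\<bar> \<le> 2" using D[of \<omega>] by auto
    have "\<bar>1 + cos (L \<omega>)\<bar> \<le> 2" using cos_ge_minus_one[of "L \<omega>"] cos_le_one[of "L \<omega>"] by linarith
    then show "\<bar>W \<omega>\<bar> \<le> 2"
      unfolding W_def abs_mult using D[of \<omega>] mult_mono[of "\<bar>D \<omega>\<bar>" 1 "\<bar>1 + cos (L \<omega>)\<bar>" 2] by auto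
  qed
  moreover have "W \<in> borel_measurable M" "W \<in> borel_measurable N"
    by (auto simp: W_def)
  \<comment> \<open>Subtracting the \<open>D\<close> integral removes the constant 1 that was added
    to make the weight nonnegative.\<close>
  ultimately have "(\<integral>\<omega>. W \<omega> * indicator (A k) (Y k \<omega>) - D \<omega> * indicator (A k) (Y k \<omega>) \<partial>M) =
      (\<integral>\<omega>. W \<omega> * indicator (A k) (Y k \<omega>) - D \<omega> * indicator (A k) (Y k \<omega>) \<partial>N)"
    using Dm by (simp add: Bochner_Integration.integral_diff)
  moreover have "W \<omega> * indicator (A k) (Y k \<omega>) - D \<omega> * indicator (A k) (Y k \<omega>) =
      (\<Prod>i\<in>insert k S. indicator (A i) (Y i \<omega>)) * cos ((\<Sum>t\<in>T. c t * Y t \<omega>) + \<phi>)" for \<omega>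
    using insert.hyps by (simp add: W_def D_def L_def algebra_simps)
  ultimately show ?case by simp
qed

text \<open>With an empty linear combination and phase zero the cosine is 1, and what remains of the
  weighted integral is the indicator of the cylinder.\<close>

lemma cylinder_measure_eq:
  fixes Y :: "'i \<Rightarrow> 'a \<Rightarrow> real"
  assumes M: "prob_space M" and N: "prob_space N" and sets: "sets M = sets N"
    and Y [measurable]: "\<And>i. Y i \<in> borel_measurable M"
    and eq: "\<And>T c \<phi>. finite T \<Longrightarrow>
      (\<integral>\<omega>. cos ((\<Sum>t\<in>T. c t * Y t \<omega>) + \<phi>) \<partial>M) = (\<integral>\<omega>. cos ((\<Sum>t\<in>T. c t * Y t \<omega>) + \<phi>) \<partial>N)"
    and S: "finite S" "\<And>i. i \<in> S \<Longrightarrow> A i \<in> sets borel"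
  shows "emeasure M {\<omega> \<in> space M. \<forall>i\<in>S. Y i \<omega> \<in> A i} = emeasure N {\<omega> \<in> space M. \<forall>i\<in>S. Y i \<omega> \<in> A i}"
proof -
  interpret M: prob_space M by fact
  interpret N: prob_space N by fact
  let ?C = "{\<omega> \<in> space M. \<forall>i\<in>S. Y i \<omega> \<in> A i}"
  have space: "space M = space N"
    using sets by (rule sets_eq_imp_space_eq)
  have C: "?C \<in> sets M"
    using S by measurable
  have ind: "(\<Prod>i\<in>S. indicator (A i) (Y i \<omega>)) = (indicator ?C \<omega> :: real)" if "\<omega> \<in> space M" for \<omega>
    using that S(1) by (auto simp: indicator_def prod_eq_1_iff)
  have "measure M ?C = (\<integral>\<omega>. (\<Prod>i\<in>S. indicator (A i) (Y i \<omega>)) * cos ((\<Sum>t\<in>{}. c t * Y t \<omega>) + 0) \<partial>M)" for c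
    using C by (simp add: ind cong: Bochner_Integration.integral_cong)
  moreover have "measure N ?C = (\<integral>\<omega>. (\<Prod>i\<in>S. indicator (A i) (Y i \<omega>)) * cos ((\<Sum>t\<in>{}. c t * Y t \<omega>) + 0) \<partial>N)" for c
    using C sets space by (simp add: ind cong: Bochner_Integration.integral_cong)
  ultimately have "measure M ?C = measure N ?C"
    using cylinder_weighted_cos_eq[OF M N sets Y eq S, where T = "{}" and \<phi> = 0] by simp
  then show ?thesis
    by (simp add: M.emeasure_eq_measure N.emeasure_eq_measure)
qed

section \<open>The Borel sets of the path space\<close>

definition path_box :: "real \<Rightarrow> real \<Rightarrow> real \<Rightarrow> real \<Rightarrow> (real \<Rightarrow> real) set" where
  "path_box a b c d = {\<omega> \<in> path_space. \<omega> ` {a..b} \<subseteq> {c..d}}"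

definition path_cylinder :: "real set \<Rightarrow> (real \<Rightarrow> real set) \<Rightarrow> (real \<Rightarrow> real) set" where
  "path_cylinder S A = {\<omega> \<in> path_space. \<forall>t\<in>S. \<omega> t \<in> A t}"

definition path_cylinders :: "(real \<Rightarrow> real) set set" where
  "path_cylinders = {path_cylinder S A |S A. finite S \<and> (\<forall>t\<in>S. A t \<in> sets borel)}"

lemma path_cylinders_subset: "path_cylinders \<subseteq> Pow path_space"
  by (auto simp: path_cylinders_def path_cylinder_def)

lemma topspace_path_topology: "topspace path_topology = path_space"
proof -
  have "path_space \<in> {{\<omega> \<in> path_space. \<omega> ` K \<subseteq> U} |K U. compact K \<and> open U}"
    by (auto intro!: exI[of _ "{}"])
  then show ?thesis
    unfolding path_topology_def topology_generated_by_topspace by blast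
qed

text \<open>A continuous path that stays in the closed interval \<open>{c..d}\<close> at all
  rational times of \<open>{a..b}\<close> stays there at all times, as \<open>a < b\<close> makes
  these times dense. This leaves countably many one-coordinate conditions.\<close>

lemma path_box_in_cylinders:
  assumes "a < b"
  shows "path_box a b c d \<in> sigma_sets path_space path_cylinders"
proof -
  let ?Q = "\<rat> \<inter> {a..b}"
  have "path_box a b c d = path_space \<inter> (\<Inter>q\<in>?Q. path_cylinder {q} (\<lambda>_. {c..d}))"
  proof safe
    fix \<omega> assume \<omega>: "\<omega> \<in> path_space" "\<omega> \<in> (\<Inter>q\<in>?Q. path_cylinder {q} (\<lambda>_. {c..d}))"
    have cont: "continuous_on UNIV \<omega>"
      using \<omega> by (simp add: path_space_def)
    have "closure ?Q = {a..b}"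
    proof -
      have "closure ({a<..<b} \<inter> \<rat>) = closure {a<..<b}"
        using closure_open_Int_superset[of "{a<..<b}" \<rat>] Rats_closure_real by (simp add: Int_commute)
      moreover have "closure {a<..<b} = {a..b}" using assms by simp
      moreover have "closure ({a<..<b} \<inter> \<rat>) \<subseteq> closure ?Q"
        by (intro closure_mono) auto
      moreover have "closure ?Q \<subseteq> {a..b}"
        by (intro closure_minimal) auto
      ultimately show ?thesis by blast
    qed
    moreover have "\<omega> ` closure ?Q \<subseteq> {c..d}"
      using \<omega>(2) continuous_on_subset[OF cont]
      by (intro image_closure_subset) (auto simp: path_cylinder_def)
    ultimately show "\<omega> \<in> path_box a b c d"
      using \<omega>(1) by (simp add: path_box_def)
  qed (auto simp: path_box_def path_cylinder_def image_subset_iff)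
  also have "\<dots> \<in> sigma_sets path_space path_cylinders"
  proof -
    have single: "path_cylinder {q} (\<lambda>_. {c..d}) \<in> sigma_sets path_space path_cylinders" for q
      unfolding path_cylinders_def by (intro sigma_sets.Basic) force
    have "?Q \<noteq> {}"
      using Rats_dense_in_real[OF assms] by force
    moreover have "(\<Inter>q\<in>?Q. path_cylinder {q} (\<lambda>_. {c..d})) \<in> sigma_sets path_space path_cylinders"
      if "?Q \<noteq> {}"
    proof -
      interpret sigma_algebra path_space "sigma_sets path_space path_cylinders"
        using path_cylinders_subset by (rule sigma_algebra_sigma_sets)
      show ?thesis
        using that countable_rat single
        by (intro countable_INT') (auto intro: countable_subset)
    qed
    moreover have "(\<Inter>q\<in>?Q. path_cylinder {q} (\<lambda>_. {c..d})) \<subseteq> path_space"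
      if "?Q \<noteq> {}"
      using that by (auto simp: path_cylinder_def)
    ultimately show ?thesis
      by (simp add: Int_absorb1)
  qed
  finally show ?thesis .
qed

section \<open>A countable network for the compact-open topology\<close>

definition rational_boxes :: "(real \<Rightarrow> real) set set" where
  "rational_boxes = {path_box a b c d |a b c d. a \<in> \<rat> \<and> b \<in> \<rat> \<and> c \<in> \<rat> \<and> d \<in> \<rat> \<and> a < b}"

lemma countable_rational_boxes: "countable rational_boxes"
proof -
  have "rational_boxes \<subseteq> (\<lambda>(a, b, c, d). path_box a b c d) ` (\<rat> \<times> \<rat> \<times> \<rat> \<times> \<rat>)"
    by (force simp: rational_boxes_def)
  moreover have "countable \<dots>"
    by (intro countable_image countable_SIGMA countable_rat)
  ultimately show ?thesis by (rule countable_subset)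
qed

lemma rational_box_around:
  assumes \<omega>: "\<omega> \<in> path_space" and "open U" "\<omega> x \<in> U"
  obtains a b c d where "path_box a b c d \<in> rational_boxes" "\<omega> \<in> path_box a b c d"
    "a < x" "x < b" "{c..d} \<subseteq> U"
proof -
  obtain e where e: "e > 0" "ball (\<omega> x) e \<subseteq> U"
    using assms(2,3) openE by blast
  obtain c where c: "c \<in> \<rat>" "\<omega> x - e < c" "c < \<omega> x"
    using Rats_dense_in_real[of "\<omega> x - e" "\<omega> x"] e(1) by auto
  obtain d where d: "d \<in> \<rat>" "\<omega> x < d" "d < \<omega> x + e"
    using Rats_dense_in_real[of "\<omega> x" "\<omega> x + e"] e(1) by auto
  have "isCont \<omega> x"
    using \<omega> by (simp add: path_space_def continuous_on_eq_continuous_at)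
  then have "\<exists>s>0. \<forall>y. dist y x < s \<longrightarrow> \<omega> y \<in> {c<..<d}"
    using c(3) d(2) open_greaterThanLessThan[of c d]
    unfolding continuous_at_open by (metis (no_types, lifting) greaterThanLessThan_iff open_dist dist_commute)
  then obtain s where s: "s > 0" "\<And>y. dist y x < s \<Longrightarrow> \<omega> y \<in> {c<..<d}" by blast
  obtain a where a: "a \<in> \<rat>" "x - s < a" "a < x"
    using Rats_dense_in_real[of "x - s" x] s(1) by auto
  obtain b where b: "b \<in> \<rat>" "x < b" "b < x + s"
    using Rats_dense_in_real[of x "x + s"] s(1) by auto
  have "\<omega> y \<in> {c..d}" if "y \<in> {a..b}" for y
    using s(2)[of y] that a b by (force simp: dist_real_def)
  then have "\<omega> \<in> path_box a b c d"
    using \<omega> by (auto simp: path_box_def)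
  moreover have "{c..d} \<subseteq> U"
    using c d e(2) by (force simp: ball_def dist_real_def subset_iff)
  moreover have "path_box a b c d \<in> rational_boxes"
    unfolding rational_boxes_def using a b c d by force
  ultimately show ?thesis using that a b by blast
qed

text \<open>A countable network of the topology: its members are built from closed conditions and
  need not be open, yet every open set is a union of them. The factor \<open>path_space\<close>
  gives the empty intersection its intended value.\<close>

definition box_intersections :: "(real \<Rightarrow> real) set set" where
  "box_intersections = {path_space \<inter> \<Inter>F |F. finite F \<and> F \<subseteq> rational_boxes}"

lemma countable_box_intersections: "countable box_intersections"
proof -
  have "box_intersections = (\<lambda>F. path_space \<inter> \<Inter>F) ` {F. finite F \<and> F \<subseteq> rational_boxes}"
    by (auto simp: box_intersections_def)
  then show ?thesis
    using countable_Collect_finite_subset[OF countable_rational_boxes] by (metis countable_image)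
qed

lemma box_intersections_sigma_sets: "V \<in> box_intersections \<Longrightarrow> V \<in> sigma_sets path_space path_cylinders"
proof -
  interpret sigma_algebra path_space "sigma_sets path_space path_cylinders"
    using path_cylinders_subset by (rule sigma_algebra_sigma_sets)
  assume "V \<in> box_intersections"
  then obtain F where F: "V = path_space \<inter> \<Inter>F" "finite F" "F \<subseteq> rational_boxes"
    by (auto simp: box_intersections_def)
  have "F \<subseteq> sigma_sets path_space path_cylinders"
    using F(3) path_box_in_cylinders by (auto simp: rational_boxes_def)
  with F(2) have "path_space \<inter> \<Inter>F \<in> sigma_sets path_space path_cylinders"
  proof (induction F)
    case (insert x F)
    then have "x \<inter> (path_space \<inter> \<Inter>F) \<in> sigma_sets path_space path_cylinders"
      by (intro Int[of x "path_space \<inter> \<Inter>F"]) auto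
    moreover have "path_space \<inter> \<Inter>(insert x F) = x \<inter> (path_space \<inter> \<Inter>F)" by auto
    ultimately show ?case by metis
  qed auto
  then show ?thesis by (simp add: F(1))
qed

text \<open>Only the subbasic sets need an argument: continuity gives a rational box around each
  point of \<open>K\<close>, and compactness leaves finitely many boxes whose open time intervals
  still cover \<open>K\<close>.\<close>

lemma open_path_nbhd:
  assumes "generate_topology_on {{\<omega> \<in> path_space. \<omega> ` K \<subseteq> U} |K U. compact K \<and> open U} G" "\<omega> \<in> G"
  shows "\<exists>V\<in>box_intersections. \<omega> \<in> V \<and> V \<subseteq> G"
  using assms
proof (induction G arbitrary: \<omega>)
  case Empty
  then show ?case by simp
next
  case (Int a b)
  have "\<omega> \<in> a" "\<omega> \<in> b"
    using Int.prems by auto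
  obtain V where V: "V \<in> box_intersections" "\<omega> \<in> V" "V \<subseteq> a"
    using Int.IH(1)[OF \<open>\<omega> \<in> a\<close>] by blast
  obtain W where W: "W \<in> box_intersections" "\<omega> \<in> W" "W \<subseteq> b"
    using Int.IH(2)[OF \<open>\<omega> \<in> b\<close>] by blast
  obtain F F' where "V = path_space \<inter> \<Inter>F" "finite F" "F \<subseteq> rational_boxes"
    "W = path_space \<inter> \<Inter>F'" "finite F'" "F' \<subseteq> rational_boxes"
    using V(1) W(1) unfolding box_intersections_def by blast
  then have "V \<inter> W = path_space \<inter> \<Inter>(F \<union> F')" "finite (F \<union> F')" "F \<union> F' \<subseteq> rational_boxes"
    by auto
  then have "V \<inter> W \<in> box_intersections"
    unfolding box_intersections_def by blast
  then show ?case
    using V(2,3) W(2,3) by (intro bexI[of _ "V \<inter> W"]) auto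
next
  case (UN K)
  from UN.prems obtain k where k: "k \<in> K" "\<omega> \<in> k" by blast
  from UN.IH[OF this] show ?case using k(1) by (meson Union_upper subset_trans)
next
  case (Basis s)
  then obtain K U where s: "s = {\<omega> \<in> path_space. \<omega> ` K \<subseteq> U}" and K: "compact K" and U: "open U"
    by blast
  have \<omega>: "\<omega> \<in> path_space" "\<And>x. x \<in> K \<Longrightarrow> \<omega> x \<in> U"
    using Basis s by auto
  have "\<exists>a b c d. path_box a b c d \<in> rational_boxes \<and> \<omega> \<in> path_box a b c d \<and> a < x \<and> x < b \<and> {c..d} \<subseteq> U"
    if "x \<in> K" for x
    using rational_box_around[OF \<omega>(1) U \<omega>(2)[OF that]] by metis
  then obtain a b c d where abcd: "\<And>x. x \<in> K \<Longrightarrow> path_box (a x) (b x) (c x) (d x) \<in> rational_boxes \<and>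
      \<omega> \<in> path_box (a x) (b x) (c x) (d x) \<and> a x < x \<and> x < b x \<and> {c x..d x} \<subseteq> U"
    by metis
  have "K \<subseteq> (\<Union>x\<in>K. {a x<..<b x})"
    using abcd by force
  then obtain K' where K': "K' \<subseteq> K" "finite K'" "K \<subseteq> (\<Union>x\<in>K'. {a x<..<b x})"
    using compactE_image[OF K, of K "\<lambda>x. {a x<..<b x}"] by auto
  let ?F = "(\<lambda>x. path_box (a x) (b x) (c x) (d x)) ` K'"
  have "path_space \<inter> \<Inter>?F \<in> box_intersections"
    unfolding box_intersections_def using K' abcd by blast
  moreover have "\<omega> \<in> path_space \<inter> \<Inter>?F"
    using \<omega>(1) abcd K'(1) by blast
  moreover have "path_space \<inter> \<Inter>?F \<subseteq> s"
  proof
    fix \<eta> assume \<eta>: "\<eta> \<in> path_space \<inter> \<Inter>?F"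
    have "\<eta> y \<in> U" if y: "y \<in> K" for y
    proof -
      obtain x where x: "x \<in> K'" "y \<in> {a x<..<b x}"
        using K'(3) y by blast
      then have "\<eta> \<in> path_box (a x) (b x) (c x) (d x)"
        using \<eta> by blast
      then have "\<eta> y \<in> {c x..d x}"
        using x(2) unfolding path_box_def image_subset_iff by simp
      then show ?thesis
        using abcd x(1) K'(1) by blast
    qed
    then show "\<eta> \<in> s"
      using \<eta> by (auto simp: s)
  qed
  ultimately show ?case by (intro bexI conjI)
qed

text \<open>An open set is the union of the network members that it contains, and there are only
  countably many. The reverse inclusion is obtained below from the measurability of the
  coordinates.\<close>

lemma path_borel_subset_sigma_cylinders: "sets path_borel \<subseteq> sigma_sets path_space path_cylinders"
proof -
  interpret sigma_algebra path_space "sigma_sets path_space path_cylinders"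
    using path_cylinders_subset by (rule sigma_algebra_sigma_sets)
  have sub: "{U. openin path_topology U} \<subseteq> Pow path_space"
    using openin_subset topspace_path_topology by blast
  have "U \<in> sigma_sets path_space path_cylinders" if "openin path_topology U" for U
  proof -
    have gen: "generate_topology_on {{\<omega> \<in> path_space. \<omega> ` K \<subseteq> U} |K U. compact K \<and> open U} U"
      using that unfolding path_topology_def openin_topology_generated_by_iff .
    have "U = \<Union>{V \<in> box_intersections. V \<subseteq> U}"
      using open_path_nbhd[OF gen] by blast
    moreover have "\<Union>{V \<in> box_intersections. V \<subseteq> U} \<in> sigma_sets path_space path_cylinders"
      using countable_box_intersections box_intersections_sigma_sets
      by (intro countable_Union) (auto intro: countable_subset)
    ultimately show ?thesis by simp
  qed
  then show ?thesis
    unfolding path_borel_def sets_measure_of[OF sub]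
    by (intro sigma_sets_subset) auto
qed

lemma space_path_borel [simp]: "space path_borel = path_space"
  unfolding path_borel_def using openin_subset topspace_path_topology
  by (subst space_measure_of) auto

section \<open>Fractional Brownian motion on the canonical space\<close>

text \<open>The characteristic function of a centred Gaussian variable in real form. Dividing by the
  standard deviation reduces to the standard normal law, whose characteristic function is real, so
  the sine part drops out. A degenerate centred variable is almost surely zero, which fits the same
  formula.\<close>

lemma centered_gaussian_cos:
  assumes "prob_space M" and g: "gaussian_rv M Z" and mean: "(\<integral>\<omega>. Z \<omega> \<partial>M) = 0"
  shows "(\<integral>\<omega>. cos (Z \<omega> + \<phi>) \<partial>M) = cos \<phi> * exp (- (\<integral>\<omega>. (Z \<omega>)\<^sup>2 \<partial>M) / 2)"
proof -
  interpret prob_space M by fact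
  have [measurable]: "Z \<in> borel_measurable M"
    using g by (simp add: gaussian_rv_def)
  obtain \<mu> where "(AE \<omega> in M. Z \<omega> = \<mu>) \<or> (\<exists>s>0. distributed M lborel Z (normal_density \<mu> s))"
    using g by (auto simp: gaussian_rv_def)
  then show ?thesis
  proof (elim disjE exE conjE)
    assume ae: "AE \<omega> in M. Z \<omega> = \<mu>"
    have "(\<integral>\<omega>. Z \<omega> \<partial>M) = (\<integral>\<omega>. \<mu> \<partial>M)"
      using ae by (intro integral_cong_AE) auto
    then have "\<mu> = 0" using mean by (simp add: prob_space)
    have "(\<integral>\<omega>. (Z \<omega>)\<^sup>2 \<partial>M) = (\<integral>\<omega>. 0 \<partial>M)"
      by (rule integral_cong_AE) (use ae \<open>\<mu> = 0\<close> in auto)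
    moreover have "(\<integral>\<omega>. cos (Z \<omega> + \<phi>) \<partial>M) = (\<integral>\<omega>. cos \<phi> \<partial>M)"
      by (rule integral_cong_AE) (use ae \<open>\<mu> = 0\<close> in auto)
    ultimately show ?thesis by (simp add: prob_space)
  next
    fix s :: real assume s: "s > 0" and D: "distributed M lborel Z (normal_density \<mu> s)"
    have "\<mu> = 0"
      using normal_distributed_expectation[OF s D] mean by simp
    have var: "(\<integral>\<omega>. (Z \<omega>)\<^sup>2 \<partial>M) = s\<^sup>2"
      using normal_distributed_variance[OF s D] mean by simp
    have D': "distributed M lborel (\<lambda>\<omega>. Z \<omega> / s) std_normal_density"
      using D normal_standard_normal_convert[OF s, of Z \<mu>] \<open>\<mu> = 0\<close> by simp
    interpret S: real_distribution std_normal_distribution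
      by (rule real_dist_normal_dist)
    have char: "(CLINT x|std_normal_distribution. iexp (s * x)) = of_real (exp (- (s\<^sup>2) / 2))"
      using char_std_normal_distribution by (metis char_def)
    have int: "complex_integrable std_normal_distribution (\<lambda>x. iexp (s * x))"
      by (rule S.integrable_const_bound[of _ 1]) auto
    have c: "(\<integral>x. cos (s * x) \<partial>std_normal_distribution) = exp (- (s\<^sup>2) / 2)"
      using integral_Re[OF int] char by (simp add: Re_exp)
    have sn: "(\<integral>x. sin (s * x) \<partial>std_normal_distribution) = 0"
      using integral_Im[OF int] char by (simp add: Im_exp)
    have "(\<integral>\<omega>. cos (Z \<omega> + \<phi>) \<partial>M) = (\<integral>\<omega>. cos (s * (Z \<omega> / s) + \<phi>) \<partial>M)"
      using s by simp
    also have "\<dots> = (\<integral>x. cos (s * x + \<phi>) \<partial>distr M lborel (\<lambda>\<omega>. Z \<omega> / s))"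
      by (subst integral_distr) auto
    also have "\<dots> = (\<integral>x. cos (s * x + \<phi>) \<partial>std_normal_distribution)"
      using D' by (simp add: distributed_def)
    also have "\<dots> = (\<integral>x. cos \<phi> * cos (s * x) - sin \<phi> * sin (s * x) \<partial>std_normal_distribution)"
      by (simp add: cos_add mult.commute)
    also have "\<dots> = cos \<phi> * exp (- (s\<^sup>2) / 2)"
      by (subst Bochner_Integration.integral_diff)
        (auto simp: c sn intro!: integrable_mult_right S.integrable_const_bound[of _ 1])
    finally show ?thesis by (simp add: var)
  qed
qed

lemma integral_power2_sum:
  assumes "\<And>i. i \<in> I \<Longrightarrow> square_integrable M (f i)"
  shows "(\<integral>\<omega>. (\<Sum>i\<in>I. f i \<omega>)\<^sup>2 \<partial>M) = (\<Sum>i\<in>I. \<Sum>j\<in>I. \<integral>\<omega>. f i \<omega> * f j \<omega> \<partial>M)"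
proof -
  have "integrable M (\<lambda>\<omega>. f i \<omega> * f j \<omega>)" if "i \<in> I" "j \<in> I" for i j
    using that assms by (intro square_integrable_mult_integrable)
  then show ?thesis
    by (simp add: power2_eq_square sum_product Bochner_Integration.integral_sum)
qed

lemma integral_scale_mult:
  fixes f g :: "'a \<Rightarrow> real"
  shows "(\<integral>\<omega>. (a * f \<omega>) * (b * g \<omega>) \<partial>M) = (a * b) * (\<integral>\<omega>. f \<omega> * g \<omega> \<partial>M)"
proof -
  have "(\<lambda>\<omega>. (a * f \<omega>) * (b * g \<omega>)) = (\<lambda>\<omega>. (a * b) * (f \<omega> * g \<omega>))"
    by (simp add: fun_eq_iff)
  then show ?thesis by simp
qed

text \<open>Convexity of \<open>x powr \<alpha>\<close>: increments of fixed length \<open>v\<close>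
  grow with the base point. The derivative is taken only at positive points, and continuity takes
  care of \<open>p = 0\<close>.\<close>

lemma powr_increments_mono:
  fixes p u v \<alpha> :: real
  assumes "\<alpha> \<ge> 1" "p \<ge> 0" "u \<ge> 0" "v \<ge> 0"
  shows "(p + u) powr \<alpha> + (p + v) powr \<alpha> \<le> p powr \<alpha> + (p + u + v) powr \<alpha>"
proof -
  let ?g = "\<lambda>x. (x + v) powr \<alpha> - x powr \<alpha>"
  have "?g p \<le> ?g (p + u)"
  proof (rule DERIV_nonneg_imp_increasing_open[of p "p + u" ?g])
    fix x assume "p < x" "x < p + u"
    then have "x > 0" using assms by simp
    then have "(?g has_real_derivative \<alpha> * (x + v) powr (\<alpha> - 1) - \<alpha> * x powr (\<alpha> - 1)) (at x)"
      using assms by (auto intro!: derivative_eq_intros)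
    moreover have "\<alpha> * (x + v) powr (\<alpha> - 1) - \<alpha> * x powr (\<alpha> - 1) \<ge> 0"
      using assms \<open>x > 0\<close> by (auto intro!: mult_left_mono powr_mono2)
    ultimately show "\<exists>y. (?g has_real_derivative y) (at x) \<and> 0 \<le> y" by blast
  next
    show "continuous_on {p..p + u} ?g"
      using assms by (auto intro!: continuous_intros continuous_on_powr')
  qed (use assms in simp)
  then show ?thesis by (simp add: algebra_simps)
qed

lemma mem_path_space_shift: "\<omega> \<in> path_space \<Longrightarrow> wiener_shift t \<omega> \<in> path_space"
  unfolding path_space_def wiener_shift_def
  by (auto intro!: continuous_intros continuous_on_compose2[of UNIV \<omega>])

section \<open>Covariance, law and shift invariance of the coordinate process\<close>

locale canonical_fbm =
  fixes H :: real and P :: "(real \<Rightarrow> real) measure"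
  assumes H: "1 / 2 < H" "H < 1" and law: "fbm_law H P"
begin

sublocale prob_space P
  using law by (simp add: fbm_law_def fractional_brownian_motion_def)

lemma sets_P: "sets P = sets path_borel"
  using law by (simp add: fbm_law_def)

lemma space_P [simp]: "space P = path_space"
  using sets_eq_imp_space_eq[OF sets_P] by simp

lemma gaussian_coord_sum: "finite T \<Longrightarrow> gaussian_rv P (\<lambda>\<omega>. \<Sum>t\<in>T. c t * coord t \<omega>)"
  using law by (simp add: fbm_law_def fractional_brownian_motion_def gaussian_process_def)

lemma coord_measurable [measurable]: "coord t \<in> borel_measurable P"
  using gaussian_coord_sum[of "{t}" "\<lambda>_. 1"] by (simp add: gaussian_rv_def)

lemma integral_coord: "(\<integral>\<omega>. coord t \<omega> \<partial>P) = 0"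
  using law by (simp add: fbm_law_def fractional_brownian_motion_def)

lemma coord_cov: "(\<integral>\<omega>. coord s \<omega> * coord t \<omega> \<partial>P) =
    (\<bar>s\<bar> powr (2 * H) + \<bar>t\<bar> powr (2 * H) - \<bar>t - s\<bar> powr (2 * H)) / 2"
  using law by (simp add: fbm_law_def fractional_brownian_motion_def)

text \<open>Integrability is read off from the covariance formula: for \<open>t \<noteq> 0\<close>
  it gives the integral of the square a nonzero value, whereas the Bochner integral of a
  non-integrable function is 0. At \<open>t = 0\<close> all paths vanish.\<close>

lemma square_integrable_coord: "square_integrable P (coord t)"
proof (cases "t = 0")
  case True
  have "integrable P (\<lambda>\<omega>. (coord t \<omega>)\<^sup>2) \<longleftrightarrow> integrable P (\<lambda>\<omega>. 0 :: real)"
    using True by (intro Bochner_Integration.integrable_cong) (auto simp: coord_def path_space_def)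
  then show ?thesis by (simp add: square_integrable_def)
next
  case False
  then have "(\<integral>\<omega>. (coord t \<omega>)\<^sup>2 \<partial>P) \<noteq> 0"
    using coord_cov[of t t] H by (simp add: power2_eq_square)
  then have "integrable P (\<lambda>\<omega>. (coord t \<omega>)\<^sup>2)"
    using not_integrable_integral_eq by blast
  then show ?thesis by (simp add: square_integrable_def)
qed

lemma square_integrable_increment: "square_integrable P (\<lambda>\<omega>. coord b \<omega> - coord a \<omega>)"
  by (intro square_integrable_diff square_integrable_coord)

lemma integrable_coord: "integrable P (coord t)"
proof -
  have "square_integrable P (\<lambda>_. 1)" by (simp add: square_integrable_def)
  from square_integrable_mult_integrable[OF square_integrable_coord[of t] this] show ?thesis by simp
qed

text \<open>The powers of the single times cancel in the expansion and only differences of times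
  survive; this is the stationarity of the increments.\<close>

lemma increment_cov:
  "(\<integral>\<omega>. (coord b \<omega> - coord a \<omega>) * (coord d \<omega> - coord c \<omega>) \<partial>P) =
    (\<bar>d - a\<bar> powr (2 * H) + \<bar>c - b\<bar> powr (2 * H) - \<bar>c - a\<bar> powr (2 * H) - \<bar>d - b\<bar> powr (2 * H)) / 2"
proof -
  have i: "integrable P (\<lambda>\<omega>. coord s \<omega> * coord t \<omega>)" for s t
    by (intro square_integrable_mult_integrable square_integrable_coord)
  have "(\<integral>\<omega>. (coord b \<omega> - coord a \<omega>) * (coord d \<omega> - coord c \<omega>) \<partial>P) =
     (\<integral>\<omega>. coord b \<omega> * coord d \<omega> - coord b \<omega> * coord c \<omega> - (coord a \<omega> * coord d \<omega> - coord a \<omega> * coord c \<omega>) \<partial>P)"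
    by (simp add: algebra_simps)
  also have "\<dots> = (\<integral>\<omega>. coord b \<omega> * coord d \<omega> \<partial>P) - (\<integral>\<omega>. coord b \<omega> * coord c \<omega> \<partial>P)
      - ((\<integral>\<omega>. coord a \<omega> * coord d \<omega> \<partial>P) - (\<integral>\<omega>. coord a \<omega> * coord c \<omega> \<partial>P))"
    by (simp add: i)
  finally show ?thesis by (simp add: coord_cov field_simps)
qed

lemma L2_norm_increment: "L2_norm P (\<lambda>\<omega>. coord b \<omega> - coord a \<omega>) = \<bar>b - a\<bar> powr H"
proof -
  have "(\<integral>\<omega>. (coord b \<omega> - coord a \<omega>)\<^sup>2 \<partial>P) = \<bar>b - a\<bar> powr (2 * H)"
    using increment_cov[of b a b a] H by (simp add: power2_eq_square abs_minus_commute)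
  also have "\<dots> = (\<bar>b - a\<bar> powr H)\<^sup>2"
    by (simp add: power2_eq_square powr_add[symmetric])
  finally show ?thesis by (simp add: L2_norm_def)
qed

text \<open>For \<open>H \<ge> 1 / 2\<close> this is the convexity of \<open>x powr (2 * H)\<close>.\<close>

lemma increment_cov_nonneg:
  assumes "a \<le> b" "b \<le> c" "c \<le> d"
  shows "0 \<le> (\<integral>\<omega>. (coord b \<omega> - coord a \<omega>) * (coord d \<omega> - coord c \<omega>) \<partial>P)"
proof -
  have "(c - b + (b - a)) powr (2 * H) + (c - b + (d - c)) powr (2 * H) \<le>
      (c - b) powr (2 * H) + (c - b + (b - a) + (d - c)) powr (2 * H)"
    using H assms by (intro powr_increments_mono) auto
  then show ?thesis
    using assms by (simp add: increment_cov)
qed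

lemma sets_P_eq_cylinders: "sets P = sigma_sets path_space path_cylinders"
proof
  show "sets P \<subseteq> sigma_sets path_space path_cylinders"
    using path_borel_subset_sigma_cylinders sets_P by simp
  have "path_cylinders \<subseteq> sets P"
  proof
    fix C assume "C \<in> path_cylinders"
    then obtain S A where C: "C = path_cylinder S A" "finite S" "\<And>t. t \<in> S \<Longrightarrow> A t \<in> sets borel"
      by (auto simp: path_cylinders_def)
    have "{\<omega> \<in> space P. \<forall>t\<in>S. coord t \<omega> \<in> A t} \<in> sets P"
      using C by measurable
    then show "C \<in> sets P"
      by (simp add: C(1) path_cylinder_def coord_def)
  qed
  then show "sigma_sets path_space path_cylinders \<subseteq> sets P"
    using sets.sigma_sets_subset[of path_cylinders P] by simp
qed

lemma measurable_shift [measurable]: "wiener_shift t \<in> measurable P P"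
proof -
  have "wiener_shift t \<in> measurable P (sigma path_space path_cylinders)"
  proof (rule measurable_measure_of)
    show "path_cylinders \<subseteq> Pow path_space" by (rule path_cylinders_subset)
    show "wiener_shift t \<in> space P \<rightarrow> path_space" by (auto intro: mem_path_space_shift)
    fix C assume "C \<in> path_cylinders"
    then obtain S A where C: "C = path_cylinder S A" "finite S" "\<And>s. s \<in> S \<Longrightarrow> A s \<in> sets borel"
      by (auto simp: path_cylinders_def)
    have "wiener_shift t -` C \<inter> space P = {\<omega> \<in> space P. \<forall>s\<in>S. coord (t + s) \<omega> - coord t \<omega> \<in> A s}"
      using mem_path_space_shift by (auto simp: C(1) path_cylinder_def coord_def wiener_shift_def)
    also have "\<dots> \<in> sets P"
      using C by measurable
    finally show "wiener_shift t -` C \<inter> space P \<in> sets P" .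
  qed
  moreover have "sets (sigma path_space path_cylinders) = sets P"
    by (simp add: sets_P_eq_cylinders path_cylinders_subset)
  ultimately show ?thesis
    using measurable_cong_sets by blast
qed

text \<open>The point is that the right-hand side does not contain \<open>\<tau>\<close>: a centred
  Gaussian combination enters only through its variance, and the variance only through differences
  of times.\<close>

lemma shifted_sum_cos:
  assumes "finite T"
  shows "(\<integral>\<omega>. cos ((\<Sum>t\<in>T. c t * (coord (\<tau> + t) \<omega> - coord \<tau> \<omega>)) + \<phi>) \<partial>P) =
    cos \<phi> * exp (- (\<Sum>s\<in>T. \<Sum>t\<in>T. c s * c t * (\<bar>s\<bar> powr (2 * H) + \<bar>t\<bar> powr (2 * H) - \<bar>t - s\<bar> powr (2 * H)) / 2) / 2)"
    (is "?lhs = _ * exp (- ?v / 2)")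
proof -
  let ?Z = "\<lambda>\<omega>. \<Sum>t\<in>T. c t * (coord (\<tau> + t) \<omega> - coord \<tau> \<omega>)"
  let ?T = "(+) \<tau> ` T"
  \<comment> \<open>All the subtracted copies of \<open>coord \<tau>\<close> are collected in one
    coefficient at \<open>\<tau>\<close>, which is added to the one already there if
    \<open>0 \<in> T\<close>. This exhibits \<open>?Z\<close> as a linear combination of
    coordinates, hence as Gaussian.\<close>
  let ?c = "\<lambda>s. (if s \<in> ?T then c (s - \<tau>) else 0) + (if s = \<tau> then - (\<Sum>t\<in>T. c t) else 0)"
  have "?Z \<omega> = (\<Sum>s\<in>insert \<tau> ?T. ?c s * coord s \<omega>)" for \<omega>
    unfolding sum_insert_coeff[OF finite_imageI[OF assms]]
    by (simp add: sum.reindex right_diff_distrib sum_subtractf sum_distrib_right)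
  then have "gaussian_rv P ?Z"
    using gaussian_coord_sum[of "insert \<tau> ?T" ?c] assms by (simp del: sum.insert)
  moreover have "(\<integral>\<omega>. ?Z \<omega> \<partial>P) = 0"
    using integrable_coord by (simp add: integral_coord)
  ultimately have "?lhs = cos \<phi> * exp (- (\<integral>\<omega>. (?Z \<omega>)\<^sup>2 \<partial>P) / 2)"
    by (intro centered_gaussian_cos prob_space_axioms)
  moreover have "(\<integral>\<omega>. (?Z \<omega>)\<^sup>2 \<partial>P) = ?v"
  proof -
    have "(\<integral>\<omega>. (?Z \<omega>)\<^sup>2 \<partial>P) = (\<Sum>s\<in>T. \<Sum>t\<in>T. \<integral>\<omega>. (c s * (coord (\<tau> + s) \<omega> - coord \<tau> \<omega>)) *
        (c t * (coord (\<tau> + t) \<omega> - coord \<tau> \<omega>)) \<partial>P)"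
      by (intro integral_power2_sum square_integrable_scale square_integrable_increment)
    also have "\<dots> = (\<Sum>s\<in>T. \<Sum>t\<in>T. c s * c t *
        (\<integral>\<omega>. (coord (\<tau> + s) \<omega> - coord \<tau> \<omega>) * (coord (\<tau> + t) \<omega> - coord \<tau> \<omega>) \<partial>P))"
      by (simp only: integral_scale_mult)
    also have "\<dots> = ?v"
      by (intro sum.cong refl) (simp add: increment_cov)
    finally show ?thesis .
  qed
  ultimately show ?thesis by simp
qed

text \<open>The case \<open>\<tau> = 0\<close> of the preceding formula, since paths start at
  0.\<close>

lemma coord_sum_cos:
  assumes "finite T"
  shows "(\<integral>\<omega>. cos ((\<Sum>t\<in>T. c t * coord t \<omega>) + \<phi>) \<partial>P) =
    cos \<phi> * exp (- (\<Sum>s\<in>T. \<Sum>t\<in>T. c s * c t * (\<bar>s\<bar> powr (2 * H) + \<bar>t\<bar> powr (2 * H) - \<bar>t - s\<bar> powr (2 * H)) / 2) / 2)"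
proof -
  have "(\<integral>\<omega>. cos ((\<Sum>t\<in>T. c t * coord t \<omega>) + \<phi>) \<partial>P) =
    (\<integral>\<omega>. cos ((\<Sum>t\<in>T. c t * (coord (0 + t) \<omega> - coord 0 \<omega>)) + \<phi>) \<partial>P)"
    by (intro Bochner_Integration.integral_cong) (auto simp: coord_def path_space_def)
  then show ?thesis
    using shifted_sum_cos[OF assms, of c 0 \<phi>] by simp
qed

text \<open>Cylinders form an intersection-stable generator, so agreement on them suffices. It
  follows from the cosine integrals, which are the same for the coordinates and for the shifted
  coordinates.\<close>

lemma distr_shift: "distr P P (wiener_shift \<tau>) = P"
proof (rule measure_eqI_generator_eq[symmetric])
  let ?N = "distr P P (wiener_shift \<tau>)"
  show "path_cylinders \<subseteq> Pow path_space" by (rule path_cylinders_subset)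
  show "Int_stable path_cylinders"
  proof (rule Int_stableI)
    fix C D assume "C \<in> path_cylinders" "D \<in> path_cylinders"
    then obtain S A T B where *: "C = path_cylinder S A" "finite S" "\<And>t. t \<in> S \<Longrightarrow> A t \<in> sets borel"
        "D = path_cylinder T B" "finite T" "\<And>t. t \<in> T \<Longrightarrow> B t \<in> sets borel"
      by (auto simp: path_cylinders_def)
    \<comment> \<open>Times constrained by only one of the two cylinders receive the whole line from
      the other, so that a single family of sets serves the union of the time sets.\<close>
    define E where "E t = (if t \<in> S then A t else UNIV) \<inter> (if t \<in> T then B t else UNIV)" for t
    have "C \<inter> D = path_cylinder (S \<union> T) E"
      by (auto simp: * path_cylinder_def E_def split: if_splits)
    moreover have "E t \<in> sets borel" for t
      using * by (simp add: E_def)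
    ultimately show "C \<inter> D \<in> path_cylinders"
      using * unfolding path_cylinders_def by blast
  qed
  show "emeasure P C = emeasure ?N C" if cyl: "C \<in> path_cylinders" for C
  proof -
    obtain S A where C: "C = path_cylinder S A" "finite S" "\<And>t. t \<in> S \<Longrightarrow> A t \<in> sets borel"
      using cyl by (auto simp: path_cylinders_def)
    have "emeasure P {\<omega> \<in> space P. \<forall>i\<in>S. coord i \<omega> \<in> A i} = emeasure ?N {\<omega> \<in> space P. \<forall>i\<in>S. coord i \<omega> \<in> A i}"
    proof (rule cylinder_measure_eq[OF prob_space_axioms])
      show "prob_space ?N" by (intro prob_space_distr) simp
      fix T :: "real set" and c \<phi> assume "finite T"
      have "(\<integral>\<omega>. cos ((\<Sum>t\<in>T. c t * coord t \<omega>) + \<phi>) \<partial>?N) =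
          (\<integral>\<omega>. cos ((\<Sum>t\<in>T. c t * (coord (\<tau> + t) \<omega> - coord \<tau> \<omega>)) + \<phi>) \<partial>P)"
        by (subst integral_distr) (simp_all add: coord_def[of _ "wiener_shift _ _"] wiener_shift_def, simp add: coord_def)
      then show "(\<integral>\<omega>. cos ((\<Sum>t\<in>T. c t * coord t \<omega>) + \<phi>) \<partial>P) =
          (\<integral>\<omega>. cos ((\<Sum>t\<in>T. c t * coord t \<omega>) + \<phi>) \<partial>?N)"
        using coord_sum_cos[OF \<open>finite T\<close>] shifted_sum_cos[OF \<open>finite T\<close>] by simp
    qed (use C in auto)
    then show ?thesis
      by (simp add: C(1) path_cylinder_def coord_def)
  qed
  show "sets P = sigma_sets path_space path_cylinders" "sets ?N = sigma_sets path_space path_cylinders"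
    by (simp_all add: sets_P_eq_cylinders)
  have "path_space = path_cylinder {} (\<lambda>_. UNIV)"
    by (simp add: path_cylinder_def)
  then show "range (\<lambda>_::nat. path_space) \<subseteq> path_cylinders"
    unfolding path_cylinders_def by blast
qed auto

section \<open>Second moments of Riemann sums\<close>

lemma riemann_sum_measurable [measurable]: "riemann_sum coord f D \<in> borel_measurable P"
  unfolding riemann_sum_def[abs_def] case_prod_beta by measurable

lemma square_integrable_riemann_sum: "square_integrable P (riemann_sum coord f D)"
  unfolding riemann_sum_def[abs_def] case_prod_beta
  by (intro square_integrable_sum square_integrable_scale square_integrable_increment)

text \<open>Since increments over disjoint intervals are nonnegatively correlated, replacing the
  coefficients by their bound increases the second moment, and the sum then telescopes.\<close>

lemma L2_norm_riemann_sum_le: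
  assumes "a \<le> b" and D: "D tagged_division_of {a..b}" and g: "\<And>x. x \<in> {a..b} \<Longrightarrow> \<bar>g x\<bar> \<le> C"
  shows "L2_norm P (riemann_sum coord g D) \<le> C * (b - a) powr H"
proof -
  define I where "I = (\<lambda>p::real \<times> real set. \<lambda>\<omega>. coord (Sup (snd p)) \<omega> - coord (Inf (snd p)) \<omega>)"
  have "C \<ge> 0" using g[of a] \<open>a \<le> b\<close> by auto
  have I: "square_integrable P (I p)" for p
    unfolding I_def by (rule square_integrable_increment)
  have cov: "0 \<le> (\<integral>\<omega>. I p \<omega> * I q \<omega> \<partial>P)" if pq: "p \<in> D" "q \<in> D" for p q
  proof (cases "p = q")
    case True
    then show ?thesis by simp
  next
    case False
    obtain a1 b1 where p: "snd p = cbox a1 b1" "fst p \<in> snd p"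
      using tagged_division_ofD(2,4)[OF D, of "fst p" "snd p"] pq by auto
    obtain a2 b2 where q: "snd q = cbox a2 b2" "fst q \<in> snd q"
      using tagged_division_ofD(2,4)[OF D, of "fst q" "snd q"] pq by auto
    have le: "a1 \<le> b1" "a2 \<le> b2" using p q by auto
    have "interior (snd p) \<inter> interior (snd q) = {}"
      using tagged_division_ofD(5)[OF D, of "fst p" "snd p" "fst q" "snd q"] pq False by simp
    then have "interior (cbox a1 b1) \<inter> interior (cbox a2 b2) = {}"
      unfolding p(1) q(1) .
    then have "{max a1 a2<..<min b1 b2} = {}"
      by auto
    then have "min b1 b2 \<le> max a1 a2"
      using dense[of "max a1 a2" "min b1 b2"] by (meson greaterThanLessThan_empty_iff not_le)
    \<comment> \<open>A tagged division may contain one-point intervals, about whose position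
      disjoint interiors say nothing; their increments are zero, so the covariance vanishes. Two
      nondegenerate intervals must be ordered.\<close>
    then have "a1 = b1 \<or> a2 = b2 \<or> b1 \<le> a2 \<or> b2 \<le> a1"
      using le by (auto simp: min_def max_def split: if_splits)
    then show ?thesis
      using le p q increment_cov_nonneg[of a1 b1 a2 b2] increment_cov_nonneg[of a2 b2 a1 b1]
      by (auto simp: I_def mult.commute)
  qed
  have "(L2_norm P (riemann_sum coord g D))\<^sup>2 = (\<Sum>p\<in>D. \<Sum>q\<in>D. \<integral>\<omega>. (g (fst p) * I p \<omega>) * (g (fst q) * I q \<omega>) \<partial>P)"
    unfolding L2_norm_power2 riemann_sum_def case_prod_beta I_def
    by (intro integral_power2_sum square_integrable_scale square_integrable_increment)
  also have "\<dots> = (\<Sum>p\<in>D. \<Sum>q\<in>D. (g (fst p) * g (fst q)) * (\<integral>\<omega>. I p \<omega> * I q \<omega> \<partial>P))"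
    by (simp only: integral_scale_mult)
  also have "\<dots> \<le> (\<Sum>p\<in>D. \<Sum>q\<in>D. C\<^sup>2 * (\<integral>\<omega>. I p \<omega> * I q \<omega> \<partial>P))"
  proof (intro sum_mono mult_right_mono cov)
    fix p q assume pq: "p \<in> D" "q \<in> D"
    have "fst p \<in> {a..b}" "fst q \<in> {a..b}"
      using tagged_division_ofD(2,3)[OF D, of "fst p" "snd p"] tagged_division_ofD(2,3)[OF D, of "fst q" "snd q"] pq by auto
    then have "\<bar>g (fst p)\<bar> * \<bar>g (fst q)\<bar> \<le> C * C"
      using g \<open>C \<ge> 0\<close> by (intro mult_mono) auto
    then show "g (fst p) * g (fst q) \<le> C\<^sup>2"
      unfolding power2_eq_square abs_mult[symmetric] by linarith
  qed
  also have "\<dots> = C\<^sup>2 * (\<integral>\<omega>. (\<Sum>p\<in>D. I p \<omega>)\<^sup>2 \<partial>P)"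
    using I by (simp add: integral_power2_sum sum_distrib_left)
  also have "(\<lambda>\<omega>. \<Sum>p\<in>D. I p \<omega>) = (\<lambda>\<omega>. coord b \<omega> - coord a \<omega>)"
    using additive_tagged_division_1[OF \<open>a \<le> b\<close> D, of "\<lambda>t. coord t _"] by (simp add: I_def case_prod_beta)
  also have "C\<^sup>2 * (\<integral>\<omega>. (coord b \<omega> - coord a \<omega>)\<^sup>2 \<partial>P) = (C * (b - a) powr H)\<^sup>2"
    using L2_norm_increment[of b a] \<open>a \<le> b\<close> by (simp add: L2_norm_power2[symmetric] power_mult_distrib)
  finally show ?thesis
    by (rule power2_le_imp_le) (simp add: \<open>C \<ge> 0\<close>)
qed

end

section \<open>Riemann sums and the fractional Ornstein-Uhlenbeck process\<close>

abbreviation fine_division :: "real \<Rightarrow> real \<Rightarrow> real \<Rightarrow> (real \<times> real set) set \<Rightarrow> bool" where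
  "fine_division \<delta> a b D \<equiv> D tagged_division_of {a..b} \<and> (\<forall>(x, K)\<in>D. diameter K < \<delta>)"

lemma eventually_mesh_filter:
  "eventually Q (mesh_filter a b) \<longleftrightarrow> (\<exists>\<delta>>0. \<forall>D. fine_division \<delta> a b D \<longrightarrow> Q D)"
proof -
  have "eventually Q (mesh_filter a b) \<longleftrightarrow>
      (\<exists>\<delta>\<in>{0<..}. eventually Q (principal {D. fine_division \<delta> a b D}))"
    unfolding mesh_filter_def
  proof (rule eventually_INF_base)
    fix d e :: real assume "d \<in> {0<..}" "e \<in> {0<..}"
    then show "\<exists>x\<in>{0<..}. principal {D. fine_division x a b D} \<le>
        inf (principal {D. fine_division d a b D}) (principal {D. fine_division e a b D})"
      by (intro bexI[of _ "min d e"]) auto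
  qed auto
  then show ?thesis
    by (auto simp: eventually_principal)
qed

lemma fine_division_ex:
  assumes "\<delta> > 0"
  obtains D where "fine_division \<delta> a b D"
proof -
  \<comment> \<open>Cousin's lemma for a constant gauge; balls of radius \<open>\<delta> / 3\<close>
    have diameter \<open>2 * \<delta> / 3\<close>, strictly below \<open>\<delta>\<close>.\<close>
  obtain D where D: "D tagged_division_of {a..b}" "(\<lambda>x. ball x (\<delta> / 3)) fine D"
    using fine_division_exists_real[of "\<lambda>x. ball x (\<delta> / 3)" a b] assms by (auto simp: gauge_ball)
  have "diameter K < \<delta>" if "(x, K) \<in> D" for x K
  proof -
    have "diameter K \<le> diameter (ball x (\<delta> / 3))"
      using D(2) that by (intro diameter_subset) (auto simp: fine_def)
    also have "\<dots> < \<delta>"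
      using assms by simp
    finally show ?thesis .
  qed
  then have "fine_division \<delta> a b D" using D(1) by auto
  then show ?thesis by (rule that)
qed

lemma fine_division_mono: "fine_division \<delta> a b D \<Longrightarrow> \<delta> \<le> \<delta>' \<Longrightarrow> fine_division \<delta>' a b D"
  by force

lemma wiener_integral_approx:
  assumes "has_wiener_integral M B f a b I" "e > 0"
  shows "\<exists>\<delta>>0. \<forall>D. fine_division \<delta> a b D \<longrightarrow> L2_dist M (riemann_sum B f D) I < e"
proof -
  have "\<forall>\<^sub>F D in mesh_filter a b. L2_dist M (riemann_sum B f D) I < e"
    using assms by (auto simp: has_wiener_integral_def L2_tendsto_def intro: order_tendstoD)
  then show ?thesis by (simp only: eventually_mesh_filter)
qed

lemma fine_division_Un:
  assumes "fine_division \<delta> a b D" "fine_division \<delta> b c E" "a \<le> b" "b \<le> c"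
  shows "fine_division \<delta> a c (D \<union> E)"
proof -
  have "(D \<union> E) tagged_division_of ({a..b} \<union> {b..c})"
    using assms by (intro tagged_division_Un) auto
  moreover have "{a..b} \<union> {b..c} = {a..c}"
    using assms by auto
  ultimately show ?thesis using assms by auto
qed

text \<open>The two divisions can share a tagged interval, but only the degenerate
  \<open>{b}\<close>, whose increment is zero. Counting it once instead of twice makes no
  difference.\<close>

lemma riemann_sum_Un:
  assumes D: "D tagged_division_of {a..b}" and E: "E tagged_division_of {b..c}"
  shows "riemann_sum B f (D \<union> E) \<omega> = riemann_sum B f D \<omega> + riemann_sum B f E \<omega>"
  unfolding riemann_sum_def
proof (rule sum.union_inter_neutral)
  show "finite D" "finite E"
    using D E by auto
  have "Sup K = Inf K" if "(x, K) \<in> D \<inter> E" for x K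
  proof -
    have "K \<subseteq> {a..b}" "K \<subseteq> {b..c}" "x \<in> K"
      using that tagged_division_ofD(2,3)[OF D] tagged_division_ofD(3)[OF E] by blast+
    then have "K = {b}" by force
    then show ?thesis by simp
  qed
  then show "\<forall>p\<in>D \<inter> E. (case p of (x, K) \<Rightarrow> f x * (B (Sup K) \<omega> - B (Inf K) \<omega>)) = 0"
    by auto
qed

definition translate_division :: "real \<Rightarrow> (real \<times> real set) set \<Rightarrow> (real \<times> real set) set" where
  "translate_division r D = (\<lambda>(x, K). (r + x, (+) r ` K)) ` D"

lemma fine_division_translate:
  assumes "fine_division \<delta> a b D"
  shows "fine_division \<delta> (r + a) (r + b) (translate_division r D)"
proof -
  have D: "D tagged_division_of {a..b}" using assms by simp
  have int: "\<exists>u v. K = {u..v} \<and> u \<le> v" if "(x, K) \<in> D" for x K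
    using tagged_division_ofD(2,4)[OF D that] by fastforce
  have tr: "\<exists>x' K'. x = r + x' \<and> K = (+) r ` K' \<and> (x', K') \<in> D" if "(x, K) \<in> translate_division r D" for x K
    using that by (auto simp: translate_division_def)
  have "translate_division r D tagged_division_of {r + a..r + b}"
  proof (rule tagged_division_ofI)
    show "finite (translate_division r D)"
      using D by (auto simp: translate_division_def)
    fix x K assume "(x, K) \<in> translate_division r D"
    then obtain x' K' where *: "x = r + x'" "K = (+) r ` K'" "(x', K') \<in> D" using tr by blast
    show "x \<in> K" using * tagged_division_ofD(2)[OF D *(3)] by simp
    show "K \<subseteq> {r + a..r + b}" using * tagged_division_ofD(3)[OF D *(3)] by auto
    show "\<exists>u v. K = cbox u v" using int[OF *(3)] * by (auto simp: image_add_atLeastAtMost)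
    fix y L assume "(y, L) \<in> translate_division r D" and ne: "(x, K) \<noteq> (y, L)"
    then obtain y' L' where **: "y = r + y'" "L = (+) r ` L'" "(y', L') \<in> D" using tr by blast
    have "interior K' \<inter> interior L' = {}"
      using ne * ** by (intro tagged_division_ofD(5)[OF D *(3) **(3)]) auto
    moreover obtain u v where K': "K' = {u..v}" using int[OF *(3)] by blast
    moreover obtain u' v' where L': "L' = {u'..v'}" using int[OF **(3)] by blast
    ultimately have disj: "{u<..<v} \<inter> {u'<..<v'} = {}" by simp
    have "y - r \<in> {u<..<v} \<inter> {u'<..<v'}" if "y \<in> {r + u<..<r + v} \<inter> {r + u'<..<r + v'}" for y
      using that by auto
    then have "{r + u<..<r + v} \<inter> {r + u'<..<r + v'} = {}"
      unfolding disj by blast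
    then show "interior K \<inter> interior L = {}"
      by (simp add: *(2) **(2) K' L' image_add_atLeastAtMost)
  next
    have snd: "{K. \<exists>x. (x, K) \<in> A} = snd ` A" for A :: "(real \<times> real set) set"
      by force
    have "snd ` translate_division r D = (`) ((+) r) ` snd ` D"
      by (simp add: translate_division_def image_image case_prod_beta)
    then have "\<Union>{K. \<exists>x. (x, K) \<in> translate_division r D} = (+) r ` \<Union>{K. \<exists>x. (x, K) \<in> D}"
      unfolding snd by (simp only: image_Union)
    also have "\<dots> = {r + a..r + b}"
      unfolding tagged_division_ofD(6)[OF D] by (simp add: image_add_atLeastAtMost)
    finally show "\<Union>{K. \<exists>x. (x, K) \<in> translate_division r D} = {r + a..r + b}" .
  qed
  moreover have "diameter K < \<delta>" if xK: "(x, K) \<in> translate_division r D" for x K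
  proof -
    obtain x' K' where *: "x = r + x'" "K = (+) r ` K'" "(x', K') \<in> D" using tr[OF xK] by blast
    have "diameter K = diameter K'"
      using int[OF *(3)] * by (auto simp: image_add_atLeastAtMost)
    then show ?thesis using assms *(3) by auto
  qed
  ultimately show ?thesis by auto
qed

lemma riemann_sum_translate:
  assumes D: "D tagged_division_of {a..b}"
  shows "riemann_sum B f (translate_division r D) \<omega> =
    (\<Sum>(x, K)\<in>D. f (r + x) * (B (r + Sup K) \<omega> - B (r + Inf K) \<omega>))"
proof -
  have "inj_on (\<lambda>(x, K). (r + x, (+) r ` K)) D"
    by (auto simp: inj_on_def inj_image_eq_iff)
  from sum.reindex[OF this, of "\<lambda>(x, K). f x * (B (Sup K) \<omega> - B (Inf K) \<omega>)"]
  have "riemann_sum B f (translate_division r D) \<omega> =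
      (\<Sum>(x, K)\<in>D. f (r + x) * (B (Sup ((+) r ` K)) \<omega> - B (Inf ((+) r ` K)) \<omega>))"
    unfolding riemann_sum_def translate_division_def by (simp add: comp_def case_prod_beta)
  also have "\<dots> = (\<Sum>(x, K)\<in>D. f (r + x) * (B (r + Sup K) \<omega> - B (r + Inf K) \<omega>))"
  proof (intro sum.cong refl, clarify)
    fix x K assume "(x, K) \<in> D"
    then obtain u v where K: "K = cbox u v" "x \<in> K"
      using tagged_division_ofD(2,4)[OF D] by blast
    then have "(+) r ` K = {r + u..r + v}" "u \<le> v"
      by (auto simp: image_add_atLeastAtMost)
    then have "Sup ((+) r ` K) = r + Sup K" "Inf ((+) r ` K) = r + Inf K"
      by (simp_all add: K(1))
    then show "f (r + x) * (B (Sup ((+) r ` K)) \<omega> - B (Inf ((+) r ` K)) \<omega>) =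
        f (r + x) * (B (r + Sup K) \<omega> - B (r + Inf K) \<omega>)"
      by (simp only:)
  qed
  finally show ?thesis .
qed

section \<open>Shift invariance of L2 distances\<close>

context canonical_fbm
begin

lemma square_integrable_comp_shift:
  assumes "square_integrable P f"
  shows "square_integrable P (\<lambda>\<omega>. f (wiener_shift \<tau> \<omega>))"
proof -
  have [measurable]: "f \<in> borel_measurable P" and "integrable (distr P P (wiener_shift \<tau>)) (\<lambda>\<omega>. (f \<omega>)\<^sup>2)"
    using assms by (auto simp: square_integrable_def distr_shift)
  then show ?thesis
    by (auto simp: square_integrable_def integrable_distr_eq)
qed

lemma L2_dist_comp_shift:
  assumes [measurable]: "f \<in> borel_measurable P" "g \<in> borel_measurable P"
  shows "L2_dist P (\<lambda>\<omega>. f (wiener_shift \<tau> \<omega>)) (\<lambda>\<omega>. g (wiener_shift \<tau> \<omega>)) = L2_dist P f g"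
proof -
  have "(\<integral>\<omega>. \<bar>f (wiener_shift \<tau> \<omega>) - g (wiener_shift \<tau> \<omega>)\<bar>\<^sup>2 \<partial>P) =
      (\<integral>\<omega>. \<bar>f \<omega> - g \<omega>\<bar>\<^sup>2 \<partial>distr P P (wiener_shift \<tau>))"
    by (subst integral_distr) auto
  then show ?thesis by (simp add: L2_dist_def distr_shift)
qed

end

section \<open>The one-step relation of the Ornstein-Uhlenbeck process\<close>

locale fractional_ou = canonical_fbm +
  fixes lam \<sigma> :: real and X :: "real \<Rightarrow> (real \<Rightarrow> real) \<Rightarrow> real"
  assumes lam: "lam > 0"
    and X: "\<And>t. has_wiener_integral_upto P coord (\<lambda>s. \<sigma> * exp (- lam * (t - s))) t (X t)"
begin

definition kernel :: "real \<Rightarrow> real \<Rightarrow> real" where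
  "kernel t = (\<lambda>s. \<sigma> * exp (- lam * (t - s)))"

lemma X_limit:
  obtains J where "\<And>s. - s \<le> t \<Longrightarrow> has_wiener_integral P coord (kernel t) (- s) t (J s)"
    "L2_tendsto P J (X t) at_top"
proof -
  from X[of t] obtain J where
    "\<forall>s. - s \<le> t \<longrightarrow> has_wiener_integral P coord (\<lambda>s. \<sigma> * exp (- lam * (t - s))) (- s) t (J s)"
    "L2_tendsto P J (X t) at_top"
    unfolding has_wiener_integral_upto_def by (elim exE conjE)
  then show ?thesis
    by (intro that[of J]) (simp_all add: kernel_def)
qed

lemma square_integrable_X: "square_integrable P (X t)"
  using X[of t] by (auto simp: has_wiener_integral_upto_def L2_tendsto_def)

text \<open>A division of \<open>{a..t}\<close> is joined to one of \<open>{t..t + h}\<close>. On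
  the old part the kernel has merely been multiplied by \<open>exp (- lam * h)\<close>; on the new
  part it differs from \<open>\<sigma>\<close> by at most
  \<open>\<bar>\<sigma>\<bar> * (1 - exp (- lam * h))\<close>, and the bound for Riemann sums
  applies to that difference. The estimate does not depend on \<open>a\<close>, so the lower
  endpoint can be sent to minus infinity.\<close>

lemma wiener_integral_step:
  assumes "h \<ge> 0" "a \<le> t"
    and J: "has_wiener_integral P coord (kernel t) a t J"
    and J': "has_wiener_integral P coord (kernel (t + h)) a (t + h) J'"
  shows "L2_norm P (\<lambda>\<omega>. J' \<omega> - exp (- lam * h) * J \<omega> - \<sigma> * (coord (t + h) \<omega> - coord t \<omega>))
     \<le> \<bar>\<sigma>\<bar> * (1 - exp (- lam * h)) * h powr H"
proof (rule field_le_epsilon)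
  fix e :: real assume "e > 0"
  then have e: "e / 2 > 0" by simp
  obtain d1 where d1: "d1 > 0" "\<And>D. fine_division d1 a t D \<Longrightarrow> L2_dist P (riemann_sum coord (kernel t) D) J < e / 2"
    using wiener_integral_approx[OF J e] by auto
  obtain d2 where d2: "d2 > 0" "\<And>D. fine_division d2 a (t + h) D \<Longrightarrow> L2_dist P (riemann_sum coord (kernel (t + h)) D) J' < e / 2"
    using wiener_integral_approx[OF J' e] by auto
  have m: "min d1 d2 > 0" using d1 d2 by simp
  obtain D where D: "fine_division (min d1 d2) a t D" using fine_division_ex[OF m] by metis
  obtain E where E: "fine_division (min d1 d2) t (t + h) E" using fine_division_ex[OF m] by metis
  let ?c = "exp (- lam * h)"
  let ?R = "riemann_sum coord (kernel t) D"
  let ?R' = "riemann_sum coord (kernel (t + h)) (D \<union> E)"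
  let ?S = "riemann_sum coord (\<lambda>x. kernel (t + h) x - \<sigma>) E"
  have sq: "square_integrable P J" "square_integrable P J'"
    using J J' by (auto simp: has_wiener_integral_def L2_tendsto_def)
  have DE: "fine_division (min d1 d2) a (t + h) (D \<union> E)"
    using D E assms by (intro fine_division_Un) auto
  have "L2_dist P ?R J < e / 2"
    by (intro d1(2) fine_division_mono[OF D]) simp
  then have 1: "L2_norm P (\<lambda>\<omega>. ?R \<omega> - J \<omega>) < e / 2"
    by (simp add: L2_dist_eq_norm)
  have "L2_dist P ?R' J' < e / 2"
    by (intro d2(2) fine_division_mono[OF DE]) simp
  then have 2: "L2_norm P (\<lambda>\<omega>. J' \<omega> - ?R' \<omega>) < e / 2"
    by (simp add: L2_dist_eq_norm L2_norm_minus_commute[of P J'])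
  have "\<bar>kernel (t + h) x - \<sigma>\<bar> \<le> \<bar>\<sigma>\<bar> * (1 - ?c)" if "x \<in> {t..t + h}" for x
  proof -
    have "kernel (t + h) x - \<sigma> = - (\<sigma> * (1 - exp (- lam * (t + h - x))))"
      by (simp add: kernel_def algebra_simps)
    moreover have "- lam * h \<le> - lam * (t + h - x)" "- lam * (t + h - x) \<le> 0"
      using that lam by auto
    then have "exp (- lam * h) \<le> exp (- lam * (t + h - x))" "exp (- lam * (t + h - x)) \<le> 1"
      by (simp_all only: exp_le_cancel_iff exp_le_one_iff)
    ultimately show ?thesis
      by (simp add: abs_mult mult_left_mono)
  qed
  then have 3: "L2_norm P ?S \<le> \<bar>\<sigma>\<bar> * (1 - ?c) * (t + h - t) powr H"
    using E assms by (intro L2_norm_riemann_sum_le) auto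
  \<comment> \<open>On Riemann sums the relation is an identity on each path, with \<open>?S\<close>
    as its only error term; mesh errors enter only when the sums are replaced by integrals.\<close>
  have R': "?R' \<omega> = ?c * ?R \<omega> + ?S \<omega> + \<sigma> * (coord (t + h) \<omega> - coord t \<omega>)" for \<omega>
  proof -
    have "riemann_sum coord (kernel (t + h)) D \<omega> = ?c * ?R \<omega>"
      unfolding riemann_sum_def sum_distrib_left
      by (intro sum.cong) (auto simp: kernel_def exp_add[symmetric] algebra_simps)
    moreover have "(\<Sum>(x, K)\<in>E. coord (Sup K) \<omega> - coord (Inf K) \<omega>) = coord (t + h) \<omega> - coord t \<omega>"
      using E \<open>h \<ge> 0\<close> by (intro additive_tagged_division_1[where f = "\<lambda>t. coord t \<omega>"]) auto
    then have "riemann_sum coord (kernel (t + h)) E \<omega> = ?S \<omega> + \<sigma> * (coord (t + h) \<omega> - coord t \<omega>)"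
      unfolding riemann_sum_def
      by (simp add: case_prod_beta left_diff_distrib sum_subtractf sum_distrib_left[symmetric])
    ultimately show ?thesis
      using riemann_sum_Un[of D a t E "t + h" coord "kernel (t + h)" \<omega>] D E by simp
  qed
  have "L2_norm P (\<lambda>\<omega>. J' \<omega> - ?c * J \<omega> - \<sigma> * (coord (t + h) \<omega> - coord t \<omega>)) =
     L2_norm P (\<lambda>\<omega>. (J' \<omega> - ?R' \<omega>) + (?c * (?R \<omega> - J \<omega>) + ?S \<omega>))"
    unfolding R' by (simp add: algebra_simps)
  also have "\<dots> \<le> L2_norm P (\<lambda>\<omega>. J' \<omega> - ?R' \<omega>) + L2_norm P (\<lambda>\<omega>. ?c * (?R \<omega> - J \<omega>) + ?S \<omega>)"
    by (intro L2_norm_triangle square_integrable_add square_integrable_diff square_integrable_scale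
        square_integrable_riemann_sum sq)
  also have "L2_norm P (\<lambda>\<omega>. ?c * (?R \<omega> - J \<omega>) + ?S \<omega>) \<le> L2_norm P (\<lambda>\<omega>. ?c * (?R \<omega> - J \<omega>)) + L2_norm P ?S"
    by (intro L2_norm_triangle square_integrable_diff square_integrable_scale
        square_integrable_riemann_sum sq)
  also have "L2_norm P (\<lambda>\<omega>. ?c * (?R \<omega> - J \<omega>)) \<le> 1 * L2_norm P (\<lambda>\<omega>. ?R \<omega> - J \<omega>)"
    unfolding L2_norm_scale using lam \<open>h \<ge> 0\<close> by (intro mult_right_mono) auto
  finally show "L2_norm P (\<lambda>\<omega>. J' \<omega> - ?c * J \<omega> - \<sigma> * (coord (t + h) \<omega> - coord t \<omega>))
     \<le> \<bar>\<sigma>\<bar> * (1 - exp (- lam * h)) * h powr H + e"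
    using 1 2 3 by simp
qed

lemma L2_norm_step:
  assumes "h \<ge> 0"
  shows "L2_norm P (\<lambda>\<omega>. X (t + h) \<omega> - exp (- lam * h) * X t \<omega> - \<sigma> * (coord (t + h) \<omega> - coord t \<omega>))
     \<le> \<bar>\<sigma>\<bar> * (1 - exp (- lam * h)) * h powr H" (is "L2_norm P ?Z \<le> ?b")
proof -
  let ?c = "exp (- lam * h)"
  obtain J where J: "\<And>s. - s \<le> t \<Longrightarrow> has_wiener_integral P coord (kernel t) (- s) t (J s)"
    "L2_tendsto P J (X t) at_top" using X_limit[of t] by metis
  obtain J' where J': "\<And>s. - s \<le> t + h \<Longrightarrow> has_wiener_integral P coord (kernel (t + h)) (- s) (t + h) (J' s)"
    "L2_tendsto P J' (X (t + h)) at_top" using X_limit[of "t + h"] by metis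
  have "\<forall>\<^sub>F s in at_top. L2_norm P ?Z \<le> ?b + (L2_dist P (J' s) (X (t + h)) + ?c * L2_dist P (J s) (X t))"
    using eventually_ge_at_top[of "- t"]
  proof eventually_elim
    case (elim s)
    have sq: "square_integrable P (J s)" "square_integrable P (J' s)"
      using J(1)[of s] J'(1)[of s] elim assms by (auto simp: has_wiener_integral_def L2_tendsto_def)
    let ?W = "\<lambda>\<omega>. J' s \<omega> - ?c * J s \<omega> - \<sigma> * (coord (t + h) \<omega> - coord t \<omega>)"
    note sqi = square_integrable_add square_integrable_diff square_integrable_scale
        square_integrable_X square_integrable_coord sq
    have "L2_norm P ?Z = L2_norm P (\<lambda>\<omega>. ?W \<omega> + ((X (t + h) \<omega> - J' s \<omega>) + ?c * (J s \<omega> - X t \<omega>)))"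
      by (simp add: algebra_simps)
    also have "\<dots> \<le> L2_norm P ?W + L2_norm P (\<lambda>\<omega>. (X (t + h) \<omega> - J' s \<omega>) + ?c * (J s \<omega> - X t \<omega>))"
      by (intro L2_norm_triangle sqi)
    also have "L2_norm P (\<lambda>\<omega>. (X (t + h) \<omega> - J' s \<omega>) + ?c * (J s \<omega> - X t \<omega>)) \<le>
        L2_norm P (\<lambda>\<omega>. X (t + h) \<omega> - J' s \<omega>) + L2_norm P (\<lambda>\<omega>. ?c * (J s \<omega> - X t \<omega>))"
      by (intro L2_norm_triangle sqi)
    also have "L2_norm P ?W \<le> ?b"
      using J(1)[of s] J'(1)[of s] elim assms by (intro wiener_integral_step[of h "-s"]) auto
    finally show ?case
      by (simp add: L2_norm_scale L2_dist_eq_norm L2_norm_minus_commute[of P "X (t + h)"])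
  qed
  moreover have "((\<lambda>s. ?b + (L2_dist P (J' s) (X (t + h)) + ?c * L2_dist P (J s) (X t))) \<longlongrightarrow> ?b + (0 + ?c * 0)) at_top"
    using J(2) J'(2) by (intro tendsto_intros) (auto simp: L2_tendsto_def)
  ultimately have "L2_norm P ?Z \<le> ?b + (0 + ?c * 0)"
    by (intro tendsto_lowerbound[of _ _ at_top]) auto
  then show ?thesis by simp
qed

text \<open>Translating a division keeps its mesh, and the kernel depends only on the distance to
  the upper endpoint. A Riemann sum evaluated at the shifted path is therefore exactly a Riemann sum
  for the translated interval; since the shift preserves \<open>P\<close>, the approximation error
  of \<open>J\<close> survives the composition.\<close>

lemma shifted_wiener_integral:
  assumes "a \<le> t + \<tau>"
    and J: "has_wiener_integral P coord (kernel (t + \<tau>)) a (t + \<tau>) J"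
    and J': "has_wiener_integral P coord (kernel t) (a - \<tau>) t J'"
  shows "L2_dist P (\<lambda>\<omega>. J (wiener_shift (- \<tau>) \<omega>)) J' = 0"
proof -
  have sq: "square_integrable P J" "square_integrable P J'"
    using J J' by (auto simp: has_wiener_integral_def L2_tendsto_def)
  have "L2_dist P (\<lambda>\<omega>. J (wiener_shift (- \<tau>) \<omega>)) J' \<le> 0 + e" if "e > 0" for e
  proof -
    have e: "e / 2 > 0" using that by simp
    obtain d1 where d1: "d1 > 0" "\<And>D. fine_division d1 a (t + \<tau>) D \<Longrightarrow> L2_dist P (riemann_sum coord (kernel (t + \<tau>)) D) J < e / 2"
      using wiener_integral_approx[OF J e] by auto
    obtain d2 where d2: "d2 > 0" "\<And>D. fine_division d2 (a - \<tau>) t D \<Longrightarrow> L2_dist P (riemann_sum coord (kernel t) D) J' < e / 2"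
      using wiener_integral_approx[OF J' e] by auto
    have m: "min d1 d2 > 0" using d1 d2 by simp
    obtain D where D: "fine_division (min d1 d2) a (t + \<tau>) D" using fine_division_ex[OF m] by metis
    let ?E = "translate_division (- \<tau>) D"
    have E: "fine_division (min d1 d2) (a - \<tau>) t ?E"
      using fine_division_translate[OF D, of "- \<tau>"] by simp
    let ?R = "riemann_sum coord (kernel (t + \<tau>)) D" and ?R' = "riemann_sum coord (kernel t) ?E"
    have RR: "?R (wiener_shift (- \<tau>) \<omega>) = ?R' \<omega>" for \<omega>
    proof -
      have "?R' \<omega> = (\<Sum>(x, K)\<in>D. kernel t (- \<tau> + x) * (coord (- \<tau> + Sup K) \<omega> - coord (- \<tau> + Inf K) \<omega>))"
        using D by (intro riemann_sum_translate) auto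
      \<comment> \<open>The constant that the Wiener shift subtracts from the path cancels in every
        increment.\<close>
      also have "\<dots> = ?R (wiener_shift (- \<tau>) \<omega>)"
        unfolding riemann_sum_def by (intro sum.cong) (auto simp: kernel_def coord_def wiener_shift_def algebra_simps)
      finally show ?thesis by simp
    qed
    have "L2_dist P (\<lambda>\<omega>. J (wiener_shift (- \<tau>) \<omega>)) J' \<le>
        L2_dist P (\<lambda>\<omega>. J (wiener_shift (- \<tau>) \<omega>)) (\<lambda>\<omega>. ?R (wiener_shift (- \<tau>) \<omega>)) + L2_dist P ?R' J'"
      unfolding RR
      by (intro L2_dist_triangle square_integrable_comp_shift sq square_integrable_riemann_sum)
    also have "L2_dist P (\<lambda>\<omega>. J (wiener_shift (- \<tau>) \<omega>)) (\<lambda>\<omega>. ?R (wiener_shift (- \<tau>) \<omega>)) = L2_dist P J ?R"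
      using sq by (intro L2_dist_comp_shift riemann_sum_measurable square_integrable_measurable)
    also have "L2_dist P J ?R \<le> e / 2"
      using d1(2)[OF fine_division_mono[OF D]] by (simp add: L2_dist_commute[of P J])
    also have "L2_dist P ?R' J' \<le> e / 2"
      using d2(2)[OF fine_division_mono[OF E]] by simp
    finally show ?thesis by simp
  qed
  then have "L2_dist P (\<lambda>\<omega>. J (wiener_shift (- \<tau>) \<omega>)) J' \<le> 0"
    by (rule field_le_epsilon)
  then show ?thesis
    using L2_dist_nonneg by (metis order_antisym)
qed

section \<open>Stationarity, uniform continuity and theta-almost periodicity\<close>

lemma square_integrable_shift_process: "square_integrable P (shift_process \<tau> X t)"
  using square_integrable_comp_shift[OF square_integrable_X] by (simp add: shift_process_def[abs_def])

lemma L2_dist_shift_process: "L2_dist P (shift_process \<tau> X t) (X t) = 0"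
proof -
  obtain J where J: "\<And>s. - s \<le> t + \<tau> \<Longrightarrow> has_wiener_integral P coord (kernel (t + \<tau>)) (- s) (t + \<tau>) (J s)"
    "L2_tendsto P J (X (t + \<tau>)) at_top" using X_limit[of "t + \<tau>"] by metis
  obtain J' where J': "\<And>s. - s \<le> t \<Longrightarrow> has_wiener_integral P coord (kernel t) (- s) t (J' s)"
    "L2_tendsto P J' (X t) at_top" using X_limit[of t] by metis
  have "\<forall>\<^sub>F s in at_top. L2_dist P (shift_process \<tau> X t) (X t) \<le>
      L2_dist P (J s) (X (t + \<tau>)) + L2_dist P (J' (s + \<tau>)) (X t)"
    using eventually_ge_at_top[of "- t - \<tau>"]
  proof eventually_elim
    case (elim s)
    have J1: "has_wiener_integral P coord (kernel (t + \<tau>)) (- s) (t + \<tau>) (J s)"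
      using J(1)[of s] elim by simp
    \<comment> \<open>Translation moves the lower endpoint \<open>- s\<close> to
      \<open>- s - \<tau>\<close>, so the approximation of \<open>X t\<close> has to be taken at the
      index \<open>s + \<tau>\<close>. The two indices tend to infinity together.\<close>
    have "- (s + \<tau>) \<le> t" using elim by simp
    from J'(1)[OF this] have J2: "has_wiener_integral P coord (kernel t) (- s - \<tau>) t (J' (s + \<tau>))"
      by simp
    have sq: "square_integrable P (J s)" "square_integrable P (J' (s + \<tau>))"
      using J1 J2 by (auto simp: has_wiener_integral_def L2_tendsto_def)
    have sq': "square_integrable P (\<lambda>\<omega>. J s (wiener_shift (- \<tau>) \<omega>))"
      using sq(1) by (rule square_integrable_comp_shift)
    have "L2_dist P (shift_process \<tau> X t) (X t) \<le>
        L2_dist P (shift_process \<tau> X t) (\<lambda>\<omega>. J s (wiener_shift (- \<tau>) \<omega>)) +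
        L2_dist P (\<lambda>\<omega>. J s (wiener_shift (- \<tau>) \<omega>)) (X t)"
      by (intro L2_dist_triangle square_integrable_shift_process sq' square_integrable_X)
    also have "L2_dist P (\<lambda>\<omega>. J s (wiener_shift (- \<tau>) \<omega>)) (X t) \<le>
        L2_dist P (\<lambda>\<omega>. J s (wiener_shift (- \<tau>) \<omega>)) (J' (s + \<tau>)) + L2_dist P (J' (s + \<tau>)) (X t)"
      by (intro L2_dist_triangle sq sq' square_integrable_X)
    also have "L2_dist P (\<lambda>\<omega>. J s (wiener_shift (- \<tau>) \<omega>)) (J' (s + \<tau>)) = 0"
      using elim by (intro shifted_wiener_integral[OF _ J1 J2]) simp
    also have "L2_dist P (shift_process \<tau> X t) (\<lambda>\<omega>. J s (wiener_shift (- \<tau>) \<omega>)) = L2_dist P (X (t + \<tau>)) (J s)"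
      unfolding shift_process_def[abs_def]
      by (intro L2_dist_comp_shift square_integrable_measurable square_integrable_X sq)
    finally show ?case by (simp add: L2_dist_commute[of P "X (t + \<tau>)"])
  qed
  moreover have "((\<lambda>s. L2_dist P (J s) (X (t + \<tau>)) + L2_dist P (J' (s + \<tau>)) (X t)) \<longlongrightarrow> 0 + 0) at_top"
  proof (intro tendsto_add)
    show "((\<lambda>s. L2_dist P (J s) (X (t + \<tau>))) \<longlongrightarrow> 0) at_top"
      using J(2) by (simp add: L2_tendsto_def)
    have "filterlim (\<lambda>s. s + \<tau>) at_top at_top"
      by (subst add.commute) (intro filterlim_tendsto_add_at_top[OF tendsto_const] filterlim_ident)
    then show "((\<lambda>s. L2_dist P (J' (s + \<tau>)) (X t)) \<longlongrightarrow> 0) at_top"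
      using J'(2) filterlim_compose[of "\<lambda>s. L2_dist P (J' s) (X t)"] by (auto simp: L2_tendsto_def)
  qed
  ultimately have "L2_dist P (shift_process \<tau> X t) (X t) \<le> 0 + 0"
    by (intro tendsto_lowerbound[of _ _ at_top]) auto
  then show ?thesis
    using L2_dist_nonneg[of P "shift_process \<tau> X t" "X t"] by linarith
qed

text \<open>Stationarity of the second moment: composing \<open>X t\<close> with the shift keeps its
  norm and turns it into a version of \<open>X 0\<close>. It makes the continuity estimate below
  uniform in time.\<close>

lemma L2_norm_X_const: "L2_norm P (X t) = L2_norm P (X 0)"
proof -
  have "L2_norm P (X t) = L2_dist P (X t) (\<lambda>_. 0)"
    by (simp add: L2_dist_eq_norm)
  also have "\<dots> = L2_dist P (shift_process t X 0) (\<lambda>_. 0)"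
    using L2_dist_comp_shift[of "X t" "\<lambda>_. 0" "- t"] square_integrable_X
    by (simp add: shift_process_def[abs_def] square_integrable_measurable)
  also have "\<dots> = L2_dist P (X 0) (\<lambda>_. 0)"
    using L2_dist_triangle[of P "shift_process t X 0" "X 0" "\<lambda>_. 0"]
      L2_dist_triangle[of P "X 0" "shift_process t X 0" "\<lambda>_. 0"]
      L2_dist_shift_process[of t 0] square_integrable_X square_integrable_shift_process
    by (simp add: L2_dist_commute[of P "X 0" "shift_process t X 0"])
  finally show ?thesis by (simp add: L2_dist_eq_norm)
qed

text \<open>A modulus of L2 continuity for \<open>X\<close>. The summands bound, in this order, the
  error of the one-step relation, the damping term \<open>(exp (- lam * h) - 1) * X t\<close>, and
  the noise increment.\<close>

definition modulus :: "real \<Rightarrow> real" where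
  "modulus h = \<bar>\<sigma>\<bar> * (1 - exp (- lam * h)) * h powr H + (1 - exp (- lam * h)) * L2_norm P (X 0) + \<bar>\<sigma>\<bar> * h powr H"

lemma L2_dist_X_le_modulus: "L2_dist P (X s) (X t) \<le> modulus \<bar>s - t\<bar>"
proof -
  have le: "L2_dist P (X (t + h)) (X t) \<le> modulus h" if "h \<ge> 0" for t h
  proof -
    let ?c = "exp (- lam * h)"
    let ?W = "\<lambda>\<omega>. X (t + h) \<omega> - ?c * X t \<omega> - \<sigma> * (coord (t + h) \<omega> - coord t \<omega>)"
    note sqi = square_integrable_add square_integrable_diff square_integrable_scale
        square_integrable_X square_integrable_coord
    have "L2_dist P (X (t + h)) (X t) = L2_norm P (\<lambda>\<omega>. (?W \<omega> + (?c - 1) * X t \<omega>) + \<sigma> * (coord (t + h) \<omega> - coord t \<omega>))"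
      by (simp add: L2_dist_eq_norm algebra_simps)
    also have "\<dots> \<le> L2_norm P (\<lambda>\<omega>. ?W \<omega> + (?c - 1) * X t \<omega>) + L2_norm P (\<lambda>\<omega>. \<sigma> * (coord (t + h) \<omega> - coord t \<omega>))"
      by (intro L2_norm_triangle sqi)
    also have "L2_norm P (\<lambda>\<omega>. ?W \<omega> + (?c - 1) * X t \<omega>) \<le> L2_norm P ?W + L2_norm P (\<lambda>\<omega>. (?c - 1) * X t \<omega>)"
      by (intro L2_norm_triangle sqi)
    also have "L2_norm P ?W \<le> \<bar>\<sigma>\<bar> * (1 - ?c) * h powr H"
      by (rule L2_norm_step[OF that])
    also have "L2_norm P (\<lambda>\<omega>. (?c - 1) * X t \<omega>) = (1 - ?c) * L2_norm P (X 0)"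
      unfolding L2_norm_scale using lam that by (simp add: L2_norm_X_const[of t])
    also have "L2_norm P (\<lambda>\<omega>. \<sigma> * (coord (t + h) \<omega> - coord t \<omega>)) = \<bar>\<sigma>\<bar> * h powr H"
      unfolding L2_norm_scale L2_norm_increment using that by simp
    finally show ?thesis by (simp add: modulus_def)
  qed
  show ?thesis
  proof (cases "t \<le> s")
    case True
    then show ?thesis using le[of "s - t" t] by simp
  next
    case False
    then show ?thesis using le[of "t - s" s] by (simp add: L2_dist_commute[of P "X s"])
  qed
qed

lemma tendsto_modulus: "((\<lambda>p. modulus \<bar>f p - f q\<bar>) \<longlongrightarrow> 0) (at q)" if "isCont f q"
proof -
  have f: "((\<lambda>p. \<bar>f p - f q\<bar>) \<longlongrightarrow> \<bar>f q - f q\<bar>) (at q)"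
    using that by (intro tendsto_intros) (simp add: isCont_def)
  then have p: "((\<lambda>p. \<bar>f p - f q\<bar> powr H) \<longlongrightarrow> 0) (at q)"
    using H by (intro tendsto_zero_powrI[of _ _ _ H]) auto
  have "((\<lambda>p. modulus \<bar>f p - f q\<bar>) \<longlongrightarrow>
     \<bar>\<sigma>\<bar> * (1 - exp (- lam * \<bar>f q - f q\<bar>)) * 0 + (1 - exp (- lam * \<bar>f q - f q\<bar>)) * L2_norm P (X 0) + \<bar>\<sigma>\<bar> * 0) (at q)"
    unfolding modulus_def by (intro tendsto_intros f p)
  then show ?thesis by simp
qed

lemma theta_almost_periodic: "theta_almost_periodic_sq P X"
  unfolding theta_almost_periodic_sq_def
proof (intro conjI allI impI)
  show "L2_continuous P (\<lambda>(t, \<tau>). shift_process \<tau> X t)"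
    unfolding L2_continuous_def L2_tendsto_def
  proof (intro allI conjI)
    fix q :: "real \<times> real"
    show "square_integrable P (case q of (t, \<tau>) \<Rightarrow> shift_process \<tau> X t)"
      by (simp add: case_prod_beta square_integrable_shift_process)
    show "\<forall>\<^sub>F p in at q. square_integrable P (case p of (t, \<tau>) \<Rightarrow> shift_process \<tau> X t)"
      by (simp add: case_prod_beta square_integrable_shift_process)
    \<comment> \<open>At distance zero from \<open>X t\<close>, the shifted process does not see
      \<open>\<tau>\<close> in L2; joint continuity in both variables reduces to continuity in
      \<open>t\<close>.\<close>
    have le: "L2_dist P (shift_process \<tau> X t) (shift_process \<tau>' X t') \<le> modulus \<bar>t - t'\<bar>" for t \<tau> t' \<tau>'
    proof -
      note sqi = square_integrable_shift_process square_integrable_X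
      have "L2_dist P (shift_process \<tau> X t) (shift_process \<tau>' X t') \<le>
          L2_dist P (shift_process \<tau> X t) (X t) + L2_dist P (X t) (shift_process \<tau>' X t')"
        by (intro L2_dist_triangle sqi)
      also have "L2_dist P (X t) (shift_process \<tau>' X t') \<le>
          L2_dist P (X t) (X t') + L2_dist P (X t') (shift_process \<tau>' X t')"
        by (intro L2_dist_triangle sqi)
      finally show ?thesis
        using L2_dist_X_le_modulus[of t t']
        by (simp add: L2_dist_shift_process L2_dist_commute[of P "X t'"])
    qed
    have "isCont fst q" by simp
    show "((\<lambda>p. L2_dist P (case p of (t, \<tau>) \<Rightarrow> shift_process \<tau> X t) (case q of (t, \<tau>) \<Rightarrow> shift_process \<tau> X t)) \<longlongrightarrow> 0) (at q)"
      by (rule Lim_null_comparison[OF _ tendsto_modulus[OF \<open>isCont fst q\<close>]]) (simp add: case_prod_beta le)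
  qed
  fix e :: real assume "e > 0"
  \<comment> \<open>Every real \<open>\<tau>\<close> is an almost period, so the length 1 is an
    arbitrary choice.\<close>
  then show "relatively_dense {\<tau>. (SUP t. ereal (L2_dist P (shift_process \<tau> X t) (X t))) \<le> ereal e}"
    by (auto simp: L2_dist_shift_process relatively_dense_def intro!: exI[of _ 1])
qed

section \<open>Failure of almost periodicity in square mean\<close>

lemma increment_cov_tendsto_0:
  "((\<lambda>\<tau>. \<integral>\<omega>. (coord h \<omega> - coord 0 \<omega>) * (coord (\<tau> + h) \<omega> - coord \<tau> \<omega>) \<partial>P) \<longlongrightarrow> 0) at_top"
proof -
  \<comment> \<open>A second difference of \<open>x powr (2 * H)\<close>, of order at most
    \<open>\<tau> powr (2 * H - 2)\<close>; it vanishes in the limit because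
    \<open>H < 1\<close>.\<close>
  have "((\<lambda>\<tau>. (\<tau> + h) powr (2 * H) + (\<tau> - h) powr (2 * H) - \<tau> powr (2 * H) - \<tau> powr (2 * H)) \<longlongrightarrow> 0) at_top"
    using H by real_asymp
  then have "((\<lambda>\<tau>. ((\<tau> + h) powr (2 * H) + (\<tau> - h) powr (2 * H) - \<tau> powr (2 * H) - \<tau> powr (2 * H)) / 2) \<longlongrightarrow> 0 / 2) at_top"
    by (rule tendsto_divide) auto
  moreover have "\<forall>\<^sub>F \<tau> in at_top. ((\<tau> + h) powr (2 * H) + (\<tau> - h) powr (2 * H) - \<tau> powr (2 * H) - \<tau> powr (2 * H)) / 2 =
     (\<integral>\<omega>. (coord h \<omega> - coord 0 \<omega>) * (coord (\<tau> + h) \<omega> - coord \<tau> \<omega>) \<partial>P)"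
    using eventually_ge_at_top[of "\<bar>h\<bar>"]
    by eventually_elim (simp add: increment_cov)
  ultimately show ?thesis
    by (auto elim: Lim_transform_eventually)
qed

text \<open>Two incompatible bounds on the distance between \<open>\<Delta> \<tau>\<close> and
  \<open>\<Delta> 0\<close>, each of norm \<open>v\<close>: an almost period forces it to be at most
  \<open>3 / 8 * v\<close>, while weak correlation at large \<open>\<tau>\<close> makes it exceed
  \<open>v\<close>.\<close>

lemma not_almost_periodic:
  assumes "\<sigma> \<noteq> 0"
  shows "\<not> almost_periodic_sq P X"
proof
  assume ap: "almost_periodic_sq P X"
  \<comment> \<open>Chosen so that \<open>lam * h = 1 / 8\<close>, whence
    \<open>1 - exp (- lam * h) \<le> 1 / 8\<close>.\<close>
  define h where "h = 1 / (8 * lam)"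
  define c where "c = exp (- lam * h)"
  define v where "v = h powr H"
  have h: "h > 0" using lam by (simp add: h_def)
  then have v: "v > 0" by (simp add: v_def)
  have c: "1 - c \<le> 1 / 8"
    using exp_ge_add_one_self[of "- lam * h"] lam by (simp add: c_def h_def)
  have c1: "0 \<le> c" "c \<le> 1" using lam h by (auto simp: c_def)
  define \<Delta> where "\<Delta> = (\<lambda>t \<omega>. coord (t + h) \<omega> - coord t \<omega>)"
  \<comment> \<open>The threshold is half the variance of an increment, which leaves the squared
    distance \<open>2 * v\<^sup>2 - 2 * cov\<close> above \<open>v\<^sup>2\<close>.\<close>
  have "\<forall>\<^sub>F \<tau> in at_top. (\<integral>\<omega>. \<Delta> 0 \<omega> * \<Delta> \<tau> \<omega> \<partial>P) < v\<^sup>2 / 2"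
    using increment_cov_tendsto_0[of h] v unfolding \<Delta>_def by (intro order_tendstoD) auto
  then obtain N where N: "\<And>\<tau>. \<tau> \<ge> N \<Longrightarrow> (\<integral>\<omega>. \<Delta> 0 \<omega> * \<Delta> \<tau> \<omega> \<partial>P) < v\<^sup>2 / 2"
    by (auto simp: eventually_at_top_linorder)
  \<comment> \<open>Two almost-period errors of size \<open>e\<close> and two one-step errors of
    size \<open>\<bar>\<sigma>\<bar> * v / 8\<close> will add up to
    \<open>3 / 8 * \<bar>\<sigma>\<bar> * v\<close>.\<close>
  define e where "e = \<bar>\<sigma>\<bar> * v / 16"
  have "e > 0" using assms v by (simp add: e_def)
  then have "relatively_dense {\<tau>. (SUP t. ereal (L2_dist P (X (t + \<tau>)) (X t))) \<le> ereal e}"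
    using ap by (simp add: almost_periodic_sq_def)
  then obtain l where l: "\<And>a. {a..a + l} \<inter> {\<tau>. (SUP t. ereal (L2_dist P (X (t + \<tau>)) (X t))) \<le> ereal e} \<noteq> {}"
    by (auto simp: relatively_dense_def)
  \<comment> \<open>Relative denseness enters only here: the set of almost periods meets
    \<open>{N..N + l}\<close> and so has a member beyond \<open>N\<close>.\<close>
  obtain \<tau> where \<tau>: "\<tau> \<ge> N" "(SUP t. ereal (L2_dist P (X (t + \<tau>)) (X t))) \<le> ereal e"
    using l[of N] by auto
  have near: "L2_dist P (X (t + \<tau>)) (X t) \<le> e" for t
    using \<tau>(2) by (simp add: SUP_le_iff)
  define W where "W = (\<lambda>t \<omega>. X (t + h) \<omega> - c * X t \<omega> - \<sigma> * \<Delta> t \<omega>)"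
  have W: "L2_norm P (W t) \<le> \<bar>\<sigma>\<bar> * v / 8" for t
  proof -
    have "L2_norm P (W t) \<le> \<bar>\<sigma>\<bar> * (1 - c) * v"
      unfolding W_def c_def v_def \<Delta>_def using h by (intro L2_norm_step) simp
    also have "\<dots> \<le> \<bar>\<sigma>\<bar> * (1 / 8) * v"
      using c v by (intro mult_right_mono mult_left_mono) auto
    finally show ?thesis by simp
  qed
  have sq\<Delta>: "square_integrable P (\<Delta> t)" for t
    unfolding \<Delta>_def by (rule square_integrable_increment)
  have sqW: "square_integrable P (W t)" for t
    unfolding W_def by (intro square_integrable_diff square_integrable_scale square_integrable_X sq\<Delta>)
  note sqi = square_integrable_add square_integrable_diff square_integrable_scale square_integrable_X sqW
  let ?A = "\<lambda>\<omega>. X (\<tau> + h) \<omega> - X h \<omega>" and ?B = "\<lambda>\<omega>. X \<tau> \<omega> - X 0 \<omega>"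
  have "\<bar>\<sigma>\<bar> * L2_norm P (\<lambda>\<omega>. \<Delta> \<tau> \<omega> - \<Delta> 0 \<omega>) = L2_norm P (\<lambda>\<omega>. \<sigma> * (\<Delta> \<tau> \<omega> - \<Delta> 0 \<omega>))"
    by (simp add: L2_norm_scale)
  \<comment> \<open>Solving the one-step relation for \<open>\<sigma> * \<Delta>\<close> at times
    \<open>\<tau>\<close> and \<open>0\<close> and subtracting: \<open>?A\<close> and
    \<open>?B\<close> compare \<open>X\<close> at times \<open>\<tau>\<close> apart, and the rest is
    the difference of the one-step errors.\<close>
  also have "\<dots> = L2_norm P (\<lambda>\<omega>. (?A \<omega> - c * ?B \<omega>) + (W 0 \<omega> - W \<tau> \<omega>))"
    by (simp add: W_def algebra_simps)
  also have "\<dots> \<le> L2_norm P (\<lambda>\<omega>. ?A \<omega> - c * ?B \<omega>) + L2_norm P (\<lambda>\<omega>. W 0 \<omega> - W \<tau> \<omega>)"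
    by (intro L2_norm_triangle sqi)
  also have "L2_norm P (\<lambda>\<omega>. ?A \<omega> - c * ?B \<omega>) \<le> L2_norm P ?A + L2_norm P (\<lambda>\<omega>. c * ?B \<omega>)"
    by (intro L2_norm_triangle_diff sqi)
  also have "L2_norm P (\<lambda>\<omega>. W 0 \<omega> - W \<tau> \<omega>) \<le> L2_norm P (W 0) + L2_norm P (W \<tau>)"
    by (intro L2_norm_triangle_diff sqi)
  also have "L2_norm P ?A \<le> e"
    using near[of h] by (simp add: L2_dist_eq_norm add.commute)
  also have "L2_norm P (\<lambda>\<omega>. c * ?B \<omega>) \<le> 1 * e"
    unfolding L2_norm_scale using near[of 0] c1 by (intro mult_mono) (auto simp: L2_dist_eq_norm)
  also have "L2_norm P (W 0) \<le> \<bar>\<sigma>\<bar> * v / 8" by (rule W)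
  also have "L2_norm P (W \<tau>) \<le> \<bar>\<sigma>\<bar> * v / 8" by (rule W)
  also have "e + 1 * e + (\<bar>\<sigma>\<bar> * v / 8 + \<bar>\<sigma>\<bar> * v / 8) = \<bar>\<sigma>\<bar> * (3 / 8 * v)"
    by (simp add: e_def)
  finally have small: "L2_norm P (\<lambda>\<omega>. \<Delta> \<tau> \<omega> - \<Delta> 0 \<omega>) \<le> 3 / 8 * v"
    using assms by (simp add: mult_le_cancel_left)
  have \<Delta>2: "(\<integral>\<omega>. (\<Delta> t \<omega>)\<^sup>2 \<partial>P) = v\<^sup>2" for t
    unfolding \<Delta>_def L2_norm_power2[symmetric] L2_norm_increment v_def using h by simp
  have "(L2_norm P (\<lambda>\<omega>. \<Delta> \<tau> \<omega> - \<Delta> 0 \<omega>))\<^sup>2 = (\<integral>\<omega>. (\<Delta> \<tau> \<omega>)\<^sup>2 + (\<Delta> 0 \<omega>)\<^sup>2 - 2 * (\<Delta> 0 \<omega> * \<Delta> \<tau> \<omega>) \<partial>P)"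
    by (simp add: L2_norm_power2 power2_diff mult_ac)
  also have "\<dots> = v\<^sup>2 + v\<^sup>2 - 2 * (\<integral>\<omega>. \<Delta> 0 \<omega> * \<Delta> \<tau> \<omega> \<partial>P)"
    using sq\<Delta> square_integrable_mult_integrable[OF sq\<Delta> sq\<Delta>, of 0 \<tau>]
    by (simp add: \<Delta>2 square_integrable_def)
  also have "\<dots> > v\<^sup>2"
    using N[OF \<tau>(1)] by simp
  finally have "v\<^sup>2 < (L2_norm P (\<lambda>\<omega>. \<Delta> \<tau> \<omega> - \<Delta> 0 \<omega>))\<^sup>2" .
  also have "\<dots> \<le> (3 / 8 * v)\<^sup>2"
    using small by (intro power_mono) auto
  also have "\<dots> \<le> v\<^sup>2"
    using v by (intro power_mono) auto
  finally show False by simp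
qed

end

theorem mainTheorem3:
  fixes H lam \<sigma> :: real
    and P :: "(real \<Rightarrow> real) measure"
    and X :: "real \<Rightarrow> (real \<Rightarrow> real) \<Rightarrow> real"
  assumes "1 / 2 < H" and "H < 1"
    and "fbm_law H P"
    and "lam > 0" and "\<sigma> \<noteq> 0"
    and "\<And>t. has_wiener_integral_upto P coord (\<lambda>s. \<sigma> * exp (- lam * (t - s))) t (X t)"
  shows "\<not> almost_periodic_sq P X \<and> theta_almost_periodic_sq P X"
proof -
  interpret fractional_ou H P lam \<sigma> X
    by unfold_locales (use assms in auto)
  show ?thesis
    using not_almost_periodic[OF assms(5)] theta_almost_periodic by simp
qed

end
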